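(* Let $J\subset R=K[x_1,\dots,x_n]$ be a generic ideal of type $(n,d_1,\dots,d_n)$, let $A=R/J$ with graded pieces $A_j$, let $\delta=d_1+\cdots+d_n-n$, and let $B_j$ denote the set of standard monomials of degree $j$ with respect to $J$. Let $0\le j\le\delta$ and $r\ge 0$ be integers. Then multiplication by $x_n^r$ from $A_j$ to $A_{j+r}$ is either injective or surjective. More precisely: (i) Suppose $|B_j|\le|B_{j+r}|$. Let $T$ denote the subset of $B_{j+r}$ consisting of the $|B_j|$ smallest monomials in $B_{j+r}$. Then $T=x_n^rB_j$. (ii) Suppose $|B_j|\ge|B_{j+r}|$. Let $T$ denote the subset of $B_j$ consisting of the $|B_{j+r}|$ smallest monomials in $B_j$. Then $B_{j+r}=x_n^rT$.
   Context: $K$ is an infinite field that is an extension of a base field $F$. The monomial order on $R$ (used for initial ideals and for "smallest") is the graded reverse lexicographic order with $x_1>\cdots>x_n$. A generic ideal of type $(n,d_1,\dots,d_n)$ is an ideal of $R$ generated by homogeneous polynomials $f_1,\dots,f_n$ with $\deg f_i=d_i\ge1$, where each $f_i=\sum_\alpha c_{i,\alpha}x^\alpha$ is a sum over all monomials of degree $d_i$ and all the coefficients $c_{i,\alpha}\in K$ (for all $i,\alpha$ together) are algebraically independent over $F$. A monomial is standard with respect to $J$ if it is not in the initial ideal $\operatorname{in}(J)$. For a monomial $m$ and a set $T$ of monomials, $mT=\{mt : t\in T\}$. *)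

theory Defs
  imports
    "HOL-Library.Poly_Mapping"
    "HOL-Algebra.QuotRing"
    "HOL-Algebra.Algebraic_Closure_Type"
begin

text \<open>
  A monomial in variables indexed by \<open>'i\<close> is its exponent vector, so the product of monomials is
  \<open>+\<close>; a polynomial maps monomials to coefficients and carries the convolution product.
\<close>

type_synonym 'i mon = "'i \<Rightarrow>\<^sub>0 nat"
type_synonym ('i, 'k) mpoly = "'i mon \<Rightarrow>\<^sub>0 'k"

definition mon_deg :: "'i mon \<Rightarrow> nat" where
  "mon_deg t = (\<Sum>i\<in>Poly_Mapping.keys t. Poly_Mapping.lookup t i)"

definition mpoly_eval :: "('i \<Rightarrow> 'k::comm_ring_1) \<Rightarrow> ('i, 'k) mpoly \<Rightarrow> 'k" where
  "mpoly_eval c p = (\<Sum>t\<in>Poly_Mapping.keys p. Poly_Mapping.lookup p t *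
      (\<Prod>i\<in>Poly_Mapping.keys t. c i ^ Poly_Mapping.lookup t i))"

definition alg_indep_family :: "'k::comm_ring_1 set \<Rightarrow> 'i set \<Rightarrow> ('i \<Rightarrow> 'k) \<Rightarrow> bool" where
  "alg_indep_family F I c \<longleftrightarrow>
    (\<forall>p :: ('i, 'k) mpoly.
       (\<forall>t. Poly_Mapping.lookup p t \<in> F) \<and> (\<forall>t\<in>Poly_Mapping.keys p. Poly_Mapping.keys t \<subseteq> I) \<and>
       mpoly_eval c p = 0 \<longrightarrow> p = 0)"

definition monomials :: "nat \<Rightarrow> nat mon set" where
  "monomials n = {t. Poly_Mapping.keys t \<subseteq> {1..n}}"

definition monomials_deg :: "nat \<Rightarrow> nat \<Rightarrow> nat mon set" where
  "monomials_deg n e = {t \<in> monomials n. mon_deg t = e}"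

text \<open>The ring \<open>K[x\<^sub>1,\<dots>,x\<^sub>n]\<close>, with \<open>K\<close> the field given by the type \<open>'k\<close>.\<close>

definition poly_ring :: "nat \<Rightarrow> (nat, 'k::field) mpoly ring" where
  "poly_ring n = ring_of_type_algebra \<lparr>carrier := {p. Poly_Mapping.keys p \<subseteq> monomials n}\<rparr>"

definition mon_poly :: "nat mon \<Rightarrow> (nat, 'k::field) mpoly" where
  "mon_poly t = Poly_Mapping.single t 1"

text \<open>As usual, the zero polynomial is homogeneous of every degree.\<close>

definition homogeneous_polys :: "nat \<Rightarrow> nat \<Rightarrow> (nat, 'k::field) mpoly set" where
  "homogeneous_polys n e = {p. Poly_Mapping.keys p \<subseteq> monomials_deg n e}"

text \<open>Graded reverse lexicographic order with \<open>x\<^sub>1 > x\<^sub>2 > \<dots>\<close>: in equal degree, the monomial with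
  the larger exponent at the last position where the two differ is the smaller one.\<close>

definition grevlex_less :: "nat mon \<Rightarrow> nat mon \<Rightarrow> bool" where
  "grevlex_less s t \<longleftrightarrow> mon_deg s < mon_deg t \<or>
    (mon_deg s = mon_deg t \<and>
      (\<exists>i. Poly_Mapping.lookup s i > Poly_Mapping.lookup t i \<and>
           (\<forall>k>i. Poly_Mapping.lookup s k = Poly_Mapping.lookup t k)))"

definition lead_mon :: "(nat, 'k::field) mpoly \<Rightarrow> nat mon" where
  "lead_mon p = (THE t. t \<in> Poly_Mapping.keys p \<and>
      (\<forall>s\<in>Poly_Mapping.keys p. s \<noteq> t \<longrightarrow> grevlex_less s t))"

definition initial_ideal :: "nat \<Rightarrow> (nat, 'k::field) mpoly set \<Rightarrow> (nat, 'k) mpoly set" where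
  "initial_ideal n J = Idl\<^bsub>poly_ring n\<^esub> {mon_poly (lead_mon p) | p. p \<in> J \<and> p \<noteq> 0}"

definition standard_monomials ::
    "nat \<Rightarrow> (nat, 'k::field) mpoly set \<Rightarrow> nat \<Rightarrow> nat mon set" where
  "standard_monomials n J e = {t \<in> monomials_deg n e. mon_poly t \<notin> initial_ideal n J}"

text \<open>The \<open>m\<close> smallest elements of a finite set of monomials (all of it, if it has fewer than
  \<open>m\<close> elements).\<close>

definition smallest_monomials :: "nat \<Rightarrow> nat mon set \<Rightarrow> nat mon set" where
  "smallest_monomials m S = {t \<in> S. card {s \<in> S. grevlex_less s t} < m}"

definition var_pow :: "nat \<Rightarrow> nat \<Rightarrow> nat mon" where
  "var_pow i r = Poly_Mapping.single i r"

definition mon_times_set :: "nat mon \<Rightarrow> nat mon set \<Rightarrow> nat mon set" where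
  "mon_times_set m T = (\<lambda>t. m + t) ` T"

text \<open>Algebraic independence forces every \<open>f i\<close> to have a nonzero coefficient at each monomial of
  degree \<open>d i\<close>, hence to have degree exactly \<open>d i\<close>.\<close>

definition generic_forms ::
    "'k::field set \<Rightarrow> nat \<Rightarrow> (nat \<Rightarrow> nat) \<Rightarrow> (nat \<Rightarrow> (nat, 'k) mpoly) \<Rightarrow> bool" where
  "generic_forms F n d f \<longleftrightarrow>
    (\<forall>i\<in>{1..n}. d i \<ge> 1 \<and> f i \<in> homogeneous_polys n (d i)) \<and>
    alg_indep_family F (SIGMA i:{1..n}. monomials_deg n (d i))
      (\<lambda>(i, t). Poly_Mapping.lookup (f i) t)"

definition generic_ideal ::
    "'k::field set \<Rightarrow> nat \<Rightarrow> (nat \<Rightarrow> nat) \<Rightarrow> (nat, 'k) mpoly set \<Rightarrow> bool" where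
  "generic_ideal F n d J \<longleftrightarrow>
    (\<exists>f. generic_forms F n d f \<and> J = Idl\<^bsub>poly_ring n\<^esub> (f ` {1..n}))"

definition quotient_piece ::
    "nat \<Rightarrow> (nat, 'k::field) mpoly set \<Rightarrow> nat \<Rightarrow> (nat, 'k) mpoly set set" where
  "quotient_piece n J e = (\<lambda>p. J +>\<^bsub>poly_ring n\<^esub> p) ` homogeneous_polys n e"

definition quotient_mult ::
    "nat \<Rightarrow> (nat, 'k::field) mpoly set \<Rightarrow> nat mon \<Rightarrow> (nat, 'k) mpoly set \<Rightarrow> (nat, 'k) mpoly set"
  where
  "quotient_mult n J m a =
     (J +>\<^bsub>poly_ring n\<^esub> mon_poly m) \<otimes>\<^bsub>poly_ring n Quot J\<^esub> a"

end

theory Submission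
  imports Defs "Jordan_Normal_Form.Determinant"
begin

text \<open>
  Write \<open>\<delta> = d\<^sub>1 + \<dots> + d\<^sub>n - n\<close>. The whole statement follows from one symmetry of the sets of standard
  monomials, \<open>B\<^sub>e = x\<^sub>n\<^bsup>e - e'\<^esup> B\<^sub>e\<^sub>'\<close> whenever \<open>e + e' = \<delta>\<close> and \<open>e' \<le> e\<close> (\<open>std_symmetric\<close>), together with
  \<open>B\<^sub>e = {}\<close> for \<open>e > \<delta>\<close>. Indeed divisors of standard monomials are standard, and among monomials of the
  same degree those with a larger exponent of \<open>x\<^sub>n\<close> are smaller, so sets of the form
  \<open>x\<^sub>n\<^bsup>r\<^esup> B\<^sub>j \<subseteq> B\<^sub>j\<^sub>+\<^sub>r\<close> are initial segments; comparing \<open>j\<close> and \<open>j + r\<close> with their mirror images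
  \<open>\<delta> - j\<close> and \<open>\<delta> - j - r\<close> gives (i) and (ii) (\<open>std_power_segments\<close>).

  The symmetry has two ingredients, a count and a surjectivity. Each of them says that a list of
  polynomials spans all forms of some degree. Such a statement means that a maximal minor, a
  polynomial in the coefficients of the forms \<open>f\<^sub>i\<close>, does not vanish; so it holds for generic forms as
  soon as it holds for one choice of forms with coefficients in \<open>K\<close> (\<open>span_gens_transfer\<close>).

  The count. For \<open>f\<^sub>i = x\<^sub>i\<close> to the power \<open>d\<^sub>i\<close> it is clear that the monomials with all exponents \<open>t\<^sub>i < d\<^sub>i\<close>
  span the quotient, so they do for generic \<open>f\<^sub>i\<close>. Then the products \<open>x\<^sup>\<alpha> f\<^sup>\<beta>\<close> with \<open>\<alpha>\<^sub>i < d\<^sub>i\<close> span the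
  polynomial ring; dividing exponents by \<open>d\<^sub>i\<close> with remainder shows that in each degree there are as
  many of them as monomials, so they form a basis, and the monomials with \<open>t\<^sub>i < d\<^sub>i\<close> are a basis of \<open>A\<close>
  (\<open>reduced_independent_mod\<close>). Reflecting exponents shows that \<open>A\<^sub>e\<close> and \<open>A\<^sub>\<delta>\<^sub>-\<^sub>e\<close> have the same dimension.

  The surjectivity. Multiplication by \<open>x\<^sub>n\<^bsup>e - e'\<^esup>\<close> maps \<open>A\<^sub>e\<^sub>'\<close> onto \<open>A\<^sub>e\<close> if \<open>e + e' = \<delta>\<close>
  (\<open>generic_lefschetz\<close>). The special forms are \<open>x\<^sub>1\<close> to the power \<open>d\<^sub>1\<close> and, for \<open>k \<ge> 1\<close>, a form in \<open>x\<^sub>k\<close> and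
  \<open>x\<^sub>k\<^sub>+\<^sub>1\<close> only, whose coefficients are algebraically independent. Induct on the number of variables: surjectivity for
  \<open>k\<close> variables splits the quotient into strings \<open>w, y w, y\<^sup>2 w, \<dots>\<close> under \<open>y = x\<^sub>k\<close>, with \<open>y\<^sup>m w = 0\<close> and all strings
  centred at the middle degree (\<open>lefschetz_decomposition\<close>). Adjoining \<open>x = x\<^sub>k\<^sub>+\<^sub>1\<close> turns a string into
  the binary algebra \<open>K[y, x]/(y\<^sup>m, f\<^sub>k\<^sub>+\<^sub>1)\<close>, in which the claim is a square linear system with a
  Toeplitz matrix formed from the coefficients of \<open>f\<^sub>k\<^sub>+\<^sub>1\<close>. Its determinant is a nonzero polynomial,
  because it is \<open>1\<close> when the coefficient on the diagonal is \<open>1\<close> and all others are \<open>0\<close>. No step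
  depends on the characteristic of \<open>K\<close>.

  Surjectivity determines leading monomials because of the choice of monomial order: if a standard monomial
  of degree \<open>e\<close> were not divisible by \<open>x\<^sub>n\<^bsup>e - e'\<^esup>\<close>, then it would be congruent modulo \<open>J\<close> to a
  combination of multiples of \<open>x\<^sub>n\<^bsup>e - e'\<^esup>\<close>, all of which are smaller.
\<close>

abbreviation "lookup \<equiv> Poly_Mapping.lookup"
abbreviation "keys \<equiv> Poly_Mapping.keys"
abbreviation "single \<equiv> Poly_Mapping.single"

section \<open>Bases modulo a subspace\<close>

context vector_space begin

text \<open>
  A spanning set that is no larger than some independent set contains no redundant vector.
\<close>

lemma spanning_card_le_imp_independent:
  assumes "independent Z" "finite Y" "Z \<subseteq> span Y" "card Y \<le> card Z"
  shows "independent Y"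
proof -
  obtain Y' where Y': "Y' \<subseteq> Y" "independent Y'" "Y \<subseteq> span Y'"
    using maximal_independent_subset by blast
  have "finite Y'" using Y'(1) assms(2) finite_subset by blast
  moreover have "Z \<subseteq> span Y'" using assms(3) Y'(3) span_minimal subspace_span by blast
  ultimately have "card Z \<le> card Y'" using independent_span_bound assms(1) by blast
  then have "card Y \<le> card Y'" using assms(4) by simp
  then have "Y' = Y" using Y'(1) assms(2) card_seteq by blast
  then show ?thesis using Y'(2) by simp
qed

lemma independent_Un:
  assumes "independent Z" "independent Y" "span Z \<inter> span Y \<subseteq> {0}" "finite Z" 
  shows "independent (Z \<union> Y)"
  using assms(4,1,3)
proof (induction Z)
  case (insert x Z)
  have "independent Z" using insert.prems(1) independent_mono by blast
  moreover have "span Z \<inter> span Y \<subseteq> {0}"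
    using insert.prems(2) span_mono[of Z "insert x Z"] by blast
  ultimately have I: "independent (Z \<union> Y)" using insert.IH by blast
  have "x \<notin> span (Z \<union> Y)"
  proof
    assume "x \<in> span (Z \<union> Y)"
    then obtain u v where uv: "u \<in> span Z" "v \<in> span Y" "x = u + v"
      unfolding span_Un by blast
    have "u \<in> span (insert x Z)" using uv(1) span_mono[of Z "insert x Z"] by blast
    then have "x - u \<in> span (insert x Z)" by (metis insertI1 span_base span_diff)
    moreover have "x - u = v" using uv(3) by simp
    ultimately have "v \<in> span (insert x Z) \<inter> span Y" using uv(2) by simp
    then have "v = 0" using insert.prems(2) by blast
    then have "x \<in> span Z" using uv by simp
    then show False
      using insert.prems(1) insert.hyps(2) by (simp add: independent_insert)
  qed
  then show ?case using I by (simp add: independent_insertI)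
qed (use assms(2) in auto)

lemma independent_span_Int:
  assumes "independent C" "A \<subseteq> C" "B \<subseteq> C" "A \<inter> B = {}"
  shows "span A \<inter> span B \<subseteq> {0}"
proof
  fix x assume x: "x \<in> span A \<inter> span B"
  have "representation C x = representation A x" "representation C x = representation B x"
    using x assms by (auto intro!: representation_extend)
  then have "representation C x b = 0" for b
    using representation_ne_zero[of A x b] representation_ne_zero[of B x b] assms(4) by auto
  moreover have "x \<in> span C" using x span_mono[OF assms(2)] by auto
  ultimately show "x \<in> {0}"
    using sum_nonzero_representation_eq[OF assms(1), of x] by simp
qed

text \<open>
  An exchange lemma modulo \<open>S\<close>: extend both families by a basis of \<open>S\<close> and compare inside the span
  of the second one. The finite set \<open>G\<close> only serves to make \<open>S\<close> finite-dimensional.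
\<close>

lemma card_le_of_independent_mod:
  assumes Z: "independent Z" "finite Z" "span Z \<inter> S \<subseteq> {0}"
    and S: "subspace S" "S \<subseteq> span G" "finite G"
    and Y: "finite Y" "Z \<subseteq> span (Y \<union> S)"
  shows "card Z \<le> card Y"
proof -
  obtain b where b: "b \<subseteq> S" "independent b" "S \<subseteq> span b"
    using maximal_independent_subset by blast
  have "finite b" using independent_span_bound[of G b] S b by auto
  have Sb: "span b = S" using b S(1) span_minimal by blast
  have "independent (Z \<union> b)" using independent_Un[of Z b] Z b(2) Sb by simp
  moreover have "Z \<union> b \<subseteq> span (Y \<union> b)"
  proof -
    have "span (Y \<union> S) \<subseteq> span (Y \<union> b)"
      using b(3) span_mono[of b "Y \<union> b"] span_superset[of "Y \<union> b"]
      by (intro span_minimal) (auto intro: subspace_span)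
    then show ?thesis using Y(2) span_superset[of "Y \<union> b"] by auto
  qed
  ultimately have "card (Z \<union> b) \<le> card (Y \<union> b)"
    using independent_span_bound[of "Y \<union> b"] Y(1) \<open>finite b\<close> by blast
  moreover have "Z \<inter> b = {}"
  proof -
    have "0 \<notin> Z" using Z(1) dependent_zero by blast
    then show ?thesis using Z(3) b(1) span_superset[of Z] by blast
  qed
  ultimately show ?thesis
    using card_Un_le[of Y b] Z(2) \<open>finite b\<close> by (simp add: card_Un_disjoint)
qed

end

section \<open>Polynomials as a vector space\<close>

definition scale :: "'k::field \<Rightarrow> (nat, 'k) mpoly \<Rightarrow> (nat, 'k) mpoly" where
  "scale c p = single 0 c * p"

lemma lookup_scale [simp]: "lookup (scale c p) t = c * lookup p t"
  by (simp add: scale_def mult_map_scale_conv_mult[symmetric] Poly_Mapping.map.rep_eq when_def)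

interpretation vs: vector_space scale
  by unfold_locales
    (auto intro!: poly_mapping_eqI simp: lookup_add algebra_simps)

lemma scale_mult_left: "scale c p * q = scale c (p * q)"
  by (simp add: scale_def mult.assoc)

lemma scale_mult_right: "p * scale c q = scale c (p * q)"
  by (simp add: scale_def mult.left_commute)

lemma keys_scale_subset: "keys (scale c p) \<subseteq> keys p"
  by (auto simp: in_keys_iff)

lemma lookup_mon_poly: "lookup (mon_poly t) s = (if s = t then 1 else 0)"
  by (simp add: mon_poly_def lookup_single when_def)

lemma keys_mon_poly [simp]: "keys (mon_poly t :: (nat, 'k::field) mpoly) = {t}"
  by (simp add: mon_poly_def)

lemma mon_poly_add: "mon_poly (s + t) = mon_poly s * mon_poly t"
  by (simp add: mon_poly_def mult_single)

lemma mon_poly_zero [simp]: "mon_poly 0 = 1"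
  by (simp add: mon_poly_def)

lemma inj_mon_poly: "inj (mon_poly :: nat mon \<Rightarrow> (nat, 'k::field) mpoly)"
  by (rule injI)
    (metis keys_mon_poly singleton_inject)

lemma sum_monomials: "p = (\<Sum>t\<in>keys p. scale (lookup p t) (mon_poly t))"
  by (rule poly_mapping_eqI)
    (simp add: lookup_sum lookup_mon_poly if_distrib[of "(*) _"] in_keys_iff cong: if_cong)

lemma span_mon_poly: "vs.span (mon_poly ` Z) = {p :: (nat, 'k::field) mpoly. keys p \<subseteq> Z}"
proof
  have "vs.subspace {p :: (nat, 'k) mpoly. keys p \<subseteq> Z}"
  proof (rule vs.subspaceI)
    fix p q :: "(nat, 'k) mpoly" and c
    assume p: "p \<in> {p. keys p \<subseteq> Z}"
    then show "scale c p \<in> {p. keys p \<subseteq> Z}"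
      using keys_scale_subset[of c p] by auto
    assume "q \<in> {p. keys p \<subseteq> Z}"
    then show "p + q \<in> {p. keys p \<subseteq> Z}"
      using p Poly_Mapping.keys_add[of p q] by auto
  qed simp
  then show "vs.span (mon_poly ` Z) \<subseteq> {p :: (nat, 'k) mpoly. keys p \<subseteq> Z}"
    by (intro vs.span_minimal) auto
  show "{p :: (nat, 'k) mpoly. keys p \<subseteq> Z} \<subseteq> vs.span (mon_poly ` Z)"
  proof safe
    fix p :: "(nat, 'k) mpoly" assume "keys p \<subseteq> Z"
    then have "(\<Sum>t\<in>keys p. scale (lookup p t) (mon_poly t)) \<in> vs.span (mon_poly ` Z)"
      by (intro vs.span_sum vs.span_scale vs.span_base) auto
    then show "p \<in> vs.span (mon_poly ` Z)"
      by (simp only: sum_monomials[symmetric])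
  qed
qed

lemma homogeneous_polys_eq_span: "homogeneous_polys n e = vs.span (mon_poly ` monomials_deg n e)"
  by (simp add: homogeneous_polys_def span_mon_poly)

lemma independent_mon_poly: "vs.independent (mon_poly ` Z :: (nat, 'k::field) mpoly set)"
proof
  assume "vs.dependent (mon_poly ` Z :: (nat, 'k) mpoly set)"
  then obtain t where "t \<in> Z" "(mon_poly t :: (nat, 'k) mpoly) \<in> vs.span (mon_poly ` Z - {mon_poly t})"
    by (auto simp: vs.dependent_def)
  moreover have "mon_poly ` Z - {mon_poly t :: (nat, 'k) mpoly} = mon_poly ` (Z - {t})"
    using inj_mon_poly by (auto simp: inj_def)
  ultimately show False by (auto simp: span_mon_poly)
qed

section \<open>Degrees of monomials\<close>

lemma mon_deg_eq_sum: "finite A \<Longrightarrow> keys t \<subseteq> A \<Longrightarrow> mon_deg t = (\<Sum>i\<in>A. lookup t i)"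
  unfolding mon_deg_def by (rule sum.mono_neutral_left) (auto simp: in_keys_iff)

lemma mon_deg_add: "mon_deg (s + t) = mon_deg s + mon_deg t"
proof -
  let ?A = "keys s \<union> keys t"
  have "keys (s + t) \<subseteq> ?A" by (rule Poly_Mapping.keys_add)
  then show ?thesis
    by (simp add: mon_deg_eq_sum[of ?A] lookup_add sum.distrib)
qed

lemma mon_deg_single [simp]: "mon_deg (single i a) = a"
  by (simp add: mon_deg_def)

lemma mon_deg_zero [simp]: "mon_deg 0 = 0"
  by (simp add: mon_deg_def)

lemma lookup_le_mon_deg: "lookup t i \<le> mon_deg t"
proof (cases "i \<in> keys t")
  case True
  then show ?thesis unfolding mon_deg_def by (intro member_le_sum) auto
qed (simp add: in_keys_iff)

lemma monomials_add: "s \<in> monomials n \<Longrightarrow> t \<in> monomials n \<Longrightarrow> s + t \<in> monomials n"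
  using Poly_Mapping.keys_add[of s t] by (auto simp: monomials_def)

lemma monomials_addD: "s + t \<in> monomials n \<Longrightarrow> s \<in> monomials n \<and> t \<in> monomials n"
  by (auto simp: monomials_def subset_iff in_keys_iff lookup_add)

lemma single_in_monomials: "i \<in> {1..n} \<Longrightarrow> single i a \<in> monomials n"
  by (auto simp: monomials_def)

lemma monomials_mono: "m \<le> n \<Longrightarrow> monomials m \<subseteq> monomials n"
  by (fastforce simp: monomials_def)

lemma finite_monomials_deg [simp]: "finite (monomials_deg n e)"
proof -
  have "lookup ` monomials_deg n e \<subseteq> {g. \<forall>i. (i \<in> {1..n} \<longrightarrow> g i \<in> {..e}) \<and> (i \<notin> {1..n} \<longrightarrow> g i = 0)}"
    using lookup_le_mon_deg by (auto simp: monomials_deg_def monomials_def in_keys_iff)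
  moreover have "finite {g::nat \<Rightarrow> nat. \<forall>i. (i \<in> {1..n} \<longrightarrow> g i \<in> {..e}) \<and> (i \<notin> {1..n} \<longrightarrow> g i = 0)}"
    by (rule finite_set_of_finite_funs) auto
  ultimately have "finite (lookup ` monomials_deg n e)" by (rule finite_subset)
  then show ?thesis
    by (rule finite_imageD) (auto simp: inj_on_def poly_mapping_eqI)
qed

lemma monomials_deg_add:
  "s \<in> monomials_deg n a \<Longrightarrow> t \<in> monomials_deg n b \<Longrightarrow> s + t \<in> monomials_deg n (a + b)"
  by (simp add: monomials_deg_def monomials_add mon_deg_add)

lemma homogeneous_mult:
  assumes "p \<in> homogeneous_polys n a" "q \<in> homogeneous_polys n b"
  shows "p * q \<in> homogeneous_polys n (a + b)"
proof -
  have "keys (p * q) \<subseteq> {s + t | s t. s \<in> keys p \<and> t \<in> keys q}"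
    by (rule Poly_Mapping.keys_mult)
  also have "\<dots> \<subseteq> monomials_deg n (a + b)"
    using assms monomials_deg_add unfolding homogeneous_polys_def by blast
  finally show ?thesis by (simp add: homogeneous_polys_def)
qed

lemma subspace_homogeneous: "vs.subspace (homogeneous_polys n e)"
  by (simp add: homogeneous_polys_eq_span vs.subspace_span)

lemma mon_poly_homogeneous: "t \<in> monomials_deg n e \<Longrightarrow> mon_poly t \<in> homogeneous_polys n e"
  by (simp add: homogeneous_polys_def)

lemma homogeneous_mono: "m \<le> n \<Longrightarrow> homogeneous_polys m e \<subseteq> homogeneous_polys n e"
  using monomials_mono[of m n] by (auto simp: homogeneous_polys_def monomials_deg_def)

text \<open>
  Multiplication by \<open>q\<close> is linear, so membership of \<open>q * p\<close> in a subspace may be tested on generators.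
\<close>

lemma mult_span_subset:
  assumes "\<And>x. x \<in> S \<Longrightarrow> q * x \<in> V" "vs.subspace V" "p \<in> vs.span S"
  shows "q * p \<in> V"
proof -
  have "vs.subspace {p. q * p \<in> V}"
    using assms(2) by (auto simp: vs.subspace_def distrib_left scale_mult_right)
  then show ?thesis
    using assms vs.span_minimal[of S "{p. q * p \<in> V}"] by auto
qed

section \<open>Polynomial functions of algebraically independent elements\<close>

definition mon_val :: "('i \<Rightarrow> 'k::comm_ring_1) \<Rightarrow> 'i mon \<Rightarrow> 'k" where
  "mon_val c t = (\<Prod>i\<in>keys t. c i ^ lookup t i)"

lemma mon_val_superset:
  "finite A \<Longrightarrow> keys t \<subseteq> A \<Longrightarrow> mon_val c t = (\<Prod>i\<in>A. c i ^ lookup t i)"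
  unfolding mon_val_def by (rule prod.mono_neutral_left) (auto simp: in_keys_iff)

lemma mon_val_add: "mon_val c (s + t) = mon_val c s * mon_val c t"
proof -
  have "keys (s + t) \<subseteq> keys s \<union> keys t" by (rule Poly_Mapping.keys_add)
  then show ?thesis
    by (simp add: mon_val_superset[of "keys s \<union> keys t"] lookup_add power_add prod.distrib)
qed

lemma mon_val_zero [simp]: "mon_val c 0 = 1"
  by (simp add: mon_val_def)

lemma mpoly_eval_superset:
  "finite A \<Longrightarrow> keys p \<subseteq> A \<Longrightarrow> mpoly_eval c p = (\<Sum>t\<in>A. lookup p t * mon_val c t)"
  unfolding mpoly_eval_def mon_val_def
  by (rule sum.mono_neutral_left) (auto simp: in_keys_iff)

lemma mpoly_eval_add: "mpoly_eval c (p + q) = mpoly_eval c p + mpoly_eval c q"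
proof -
  have "keys (p + q) \<subseteq> keys p \<union> keys q" by (rule Poly_Mapping.keys_add)
  then show ?thesis
    by (simp add: mpoly_eval_superset[of "keys p \<union> keys q"] lookup_add distrib_right sum.distrib)
qed

lemma mpoly_eval_zero [simp]: "mpoly_eval c 0 = 0"
  by (simp add: mpoly_eval_def)

lemma mpoly_eval_single: "mpoly_eval c (single t a) = a * mon_val c t"
  by (subst mpoly_eval_superset[of "{t}"]) auto

lemma mpoly_eval_sum: "mpoly_eval c (sum g A) = (\<Sum>x\<in>A. mpoly_eval c (g x))"
  by (induction A rule: infinite_finite_induct) (auto simp: mpoly_eval_add)

lemma sum_singles: "(\<Sum>t\<in>keys p. single t (lookup p t)) = p"
  by (rule poly_mapping_eqI)
    (simp add: lookup_sum lookup_single when_def in_keys_iff)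

lemma mult_eq_sum_singles:
  fixes p q :: "('i, 'k::comm_ring_1) mpoly"
  shows "p * q = (\<Sum>s\<in>keys p. \<Sum>t\<in>keys q. single (s + t) (lookup p s * lookup q t))"
proof -
  have "p * q = (\<Sum>s\<in>keys p. single s (lookup p s)) * (\<Sum>t\<in>keys q. single t (lookup q t))"
    by (simp only: sum_singles)
  also have "\<dots> = (\<Sum>s\<in>keys p. \<Sum>t\<in>keys q. single (s + t) (lookup p s * lookup q t))"
    by (simp add: sum_product mult_single)
  finally show ?thesis .
qed

lemma mpoly_eval_mult: "mpoly_eval c (p * q) = mpoly_eval c p * mpoly_eval c q"
proof -
  have "mpoly_eval c (p * q) =
      (\<Sum>s\<in>keys p. \<Sum>t\<in>keys q. lookup p s * lookup q t * (mon_val c s * mon_val c t))"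
    by (simp add: mult_eq_sum_singles mpoly_eval_sum mpoly_eval_single mon_val_add)
  also have "\<dots> = (\<Sum>s\<in>keys p. lookup p s * mon_val c s) * (\<Sum>t\<in>keys q. lookup q t * mon_val c t)"
    by (simp add: sum_product mult_ac)
  finally show ?thesis by (simp add: mpoly_eval_superset[of "keys p" p] mpoly_eval_superset[of "keys q" q])
qed

definition polys_over :: "'k::comm_ring_1 set \<Rightarrow> 'i set \<Rightarrow> ('i, 'k) mpoly set" where
  "polys_over F I = {p. (\<forall>t. lookup p t \<in> F) \<and> (\<forall>t\<in>keys p. keys t \<subseteq> I)}"

definition poly_fun :: "'k::comm_ring_1 set \<Rightarrow> 'i set \<Rightarrow> (('i \<Rightarrow> 'k) \<Rightarrow> 'k) \<Rightarrow> bool" where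
  "poly_fun F I g \<longleftrightarrow> (\<exists>p\<in>polys_over F I. \<forall>c. g c = mpoly_eval c p)"

text \<open>
  An algebraically independent point behaves like a generic one: a polynomial over \<open>F\<close> that is
  nonzero somewhere is not the zero polynomial. The point \<open>c0\<close> may have coordinates outside \<open>F\<close>.
\<close>

lemma alg_indep_nonvanishing:
  assumes "alg_indep_family F I c" "poly_fun F I g" "g c0 \<noteq> 0"
  shows "g c \<noteq> 0"
proof -
  obtain p where p: "p \<in> polys_over F I" "\<And>c. g c = mpoly_eval c p"
    using assms(2) by (auto simp: poly_fun_def)
  have "p \<noteq> 0" using assms(3) p(2) by auto
  then show ?thesis
    using assms(1) p by (auto simp: alg_indep_family_def polys_over_def)
qed

context
  fixes F :: "'k::field set"
  assumes F: "subfield F (ring_of_type_algebra :: 'k ring)"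
begin

lemma subfield_closed:
  "0 \<in> F" "1 \<in> F" "\<And>a b. a \<in> F \<Longrightarrow> b \<in> F \<Longrightarrow> a + b \<in> F"
  "\<And>a b. a \<in> F \<Longrightarrow> b \<in> F \<Longrightarrow> a * b \<in> F" "\<And>a. a \<in> F \<Longrightarrow> - a \<in> F"
proof -
  interpret R: ring "ring_of_type_algebra :: 'k ring" by (rule ring_from_type_algebra)
  have S: "subring F (ring_of_type_algebra :: 'k ring)"
    using F by (simp add: subfield_def subdomain_def subcring_def)
  show "0 \<in> F" "1 \<in> F" "\<And>a b. a \<in> F \<Longrightarrow> b \<in> F \<Longrightarrow> a + b \<in> F"
    "\<And>a b. a \<in> F \<Longrightarrow> b \<in> F \<Longrightarrow> a * b \<in> F"
    using subringE(2,3,6,7)[OF S] by (auto simp: ring_of_type_algebra_def)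
  fix a assume a: "a \<in> F"
  have "a \<oplus>\<^bsub>ring_of_type_algebra\<^esub> (- a) = \<zero>\<^bsub>ring_of_type_algebra\<^esub>"
    by (simp add: ring_of_type_algebra_def)
  then have "\<ominus>\<^bsub>ring_of_type_algebra\<^esub> a = - a"
    by (intro R.minus_equality) (auto simp: ring_of_type_algebra_def)
  then show "- a \<in> F" using subringE(5)[OF S a] by simp
qed

lemma sum_in_polys_over:
  "(\<And>x. x \<in> A \<Longrightarrow> g x \<in> polys_over F I) \<Longrightarrow> sum g A \<in> polys_over F I"
proof (induction A rule: infinite_finite_induct)
  case (insert x A)
  have "keys (g x + sum g A) \<subseteq> keys (g x) \<union> keys (sum g A)" by (rule Poly_Mapping.keys_add)
  moreover have "g x \<in> polys_over F I" "sum g A \<in> polys_over F I" using insert by auto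
  ultimately have "g x + sum g A \<in> polys_over F I"
    unfolding polys_over_def mem_Collect_eq lookup_add
    by (intro conjI allI ballI subfield_closed(3)) blast+
  then show ?case using insert.hyps by simp
qed (auto simp: polys_over_def subfield_closed)

lemma single_in_polys_over: "a \<in> F \<Longrightarrow> keys t \<subseteq> I \<Longrightarrow> single t a \<in> polys_over F I"
  by (auto simp: polys_over_def lookup_single when_def subfield_closed split: if_splits)

lemma mult_in_polys_over:
  assumes "p \<in> polys_over F I" "q \<in> polys_over F I"
  shows "p * q \<in> polys_over F I"
proof -
  have "keys (s + t) \<subseteq> I" if "s \<in> keys p" "t \<in> keys q" for s t
    using Poly_Mapping.keys_add[of s t] that assms unfolding polys_over_def by blast
  then show ?thesis
    using assms unfolding mult_eq_sum_singles
    by (intro sum_in_polys_over single_in_polys_over subfield_closed) (auto simp: polys_over_def)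
qed

lemma poly_fun_const: "a \<in> F \<Longrightarrow> poly_fun F I (\<lambda>_. a)"
  unfolding poly_fun_def
  by (intro bexI[of _ "single 0 a"]) (auto simp: mpoly_eval_single single_in_polys_over)

lemma poly_fun_var: "i \<in> I \<Longrightarrow> poly_fun F I (\<lambda>c. c i)"
  unfolding poly_fun_def
  by (intro bexI[of _ "single (single i 1) 1"])
    (auto simp: mpoly_eval_single single_in_polys_over mon_val_def subfield_closed)

lemma poly_fun_mult:
  "poly_fun F I g \<Longrightarrow> poly_fun F I h \<Longrightarrow> poly_fun F I (\<lambda>c. g c * h c)"
  unfolding poly_fun_def using mult_in_polys_over by (metis mpoly_eval_mult)

lemma poly_fun_sum:
  assumes "\<And>x. x \<in> A \<Longrightarrow> poly_fun F I (g x)"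
  shows "poly_fun F I (\<lambda>c. \<Sum>x\<in>A. g x c)"
proof -
  obtain p where "\<And>x. x \<in> A \<Longrightarrow> p x \<in> polys_over F I \<and> (\<forall>c. g x c = mpoly_eval c (p x))"
    using assms unfolding poly_fun_def by metis
  then show ?thesis
    unfolding poly_fun_def
    by (intro bexI[of _ "\<Sum>x\<in>A. p x"]) (auto simp: mpoly_eval_sum sum_in_polys_over)
qed

lemma poly_fun_prod:
  "(\<And>x. x \<in> A \<Longrightarrow> poly_fun F I (g x)) \<Longrightarrow> poly_fun F I (\<lambda>c. \<Prod>x\<in>A. g x c)"
  by (induction A rule: infinite_finite_induct)
    (auto intro: poly_fun_const poly_fun_mult subfield_closed)

lemma poly_fun_det:
  assumes "\<And>c. M c \<in> carrier_mat N N"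
    and "\<And>i j. i < N \<Longrightarrow> j < N \<Longrightarrow> poly_fun F I (\<lambda>c. M c $$ (i, j))"
  shows "poly_fun F I (\<lambda>c. det (M c))"
proof -
  have "signof \<pi> \<in> F" for \<pi> :: "nat \<Rightarrow> nat"
    by (auto simp: sign_def subfield_closed)
  moreover have "\<pi> i < N" if "\<pi> permutes {0..<N}" "i < N" for \<pi> i
    using permutes_in_image[OF that(1), of i] that(2) by simp
  ultimately have "poly_fun F I (\<lambda>c. \<Sum>\<pi> | \<pi> permutes {0..<N}.
      signof \<pi> * (\<Prod>i = 0..<N. M c $$ (i, \<pi> i)))"
    using assms(2) by (intro poly_fun_sum poly_fun_mult poly_fun_prod poly_fun_const) auto
  then show ?thesis by (simp add: det_def'[OF assms(1)])
qed

end

section \<open>Toeplitz matrices\<close>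

definition toeplitz :: "nat \<Rightarrow> nat \<Rightarrow> (nat \<Rightarrow> 'k::zero) \<Rightarrow> 'k mat" where
  "toeplitz N q a = mat N N (\<lambda>(i, j). if j \<le> q + i then a (q + i - j) else 0)"

text \<open>
  Specialising the coefficient on the main diagonal to \<open>1\<close> and all others to \<open>0\<close> gives the identity
  matrix, so the determinant is a nonzero polynomial in the coefficients.
\<close>

lemma det_toeplitz_nonzero:
  fixes F :: "'k::field set"
  assumes F: "subfield F (ring_of_type_algebra :: 'k ring)"
    and c: "alg_indep_family F I c"
    and \<phi>: "inj_on \<phi> {..d}" "\<phi> ` {..d} \<subseteq> I" and "q \<le> d"
  shows "det (toeplitz N q (\<lambda>l. if l \<le> d then c (\<phi> l) else 0)) \<noteq> 0"
proof -
  let ?M = "\<lambda>c. toeplitz N q (\<lambda>l. if l \<le> d then c (\<phi> l) else 0 :: 'k)"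
  define c0 where "c0 = (\<lambda>i. if i = \<phi> q then 1 else 0 :: 'k)"
  have "poly_fun F I (\<lambda>c. det (?M c))"
  proof (rule poly_fun_det[OF F])
    fix i j assume ij: "i < N" "j < N"
    show "poly_fun F I (\<lambda>c. ?M c $$ (i, j))"
    proof (cases "j \<le> q + i \<and> q + i - j \<le> d")
      case True
      then show ?thesis
        using ij \<phi>(2) by (auto simp: toeplitz_def image_subset_iff intro: poly_fun_var[OF F])
    next
      case False
      then have "?M c $$ (i, j) = 0" for c using ij by (auto simp: toeplitz_def)
      then show ?thesis using poly_fun_const[OF F] subfield_closed(1)[OF F] by simp
    qed
  qed (simp add: toeplitz_def)
  moreover have "?M c0 = 1\<^sub>m N"
  proof (rule eq_matI)
    fix i j assume ij: "i < dim_row (1\<^sub>m N :: 'k mat)" "j < dim_col (1\<^sub>m N :: 'k mat)"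
    have "\<phi> l = \<phi> q \<longleftrightarrow> l = q" if "l \<le> d" for l
      using inj_onD[OF \<phi>(1), of l q] that \<open>q \<le> d\<close> by auto
    then show "?M c0 $$ (i, j) = 1\<^sub>m N $$ (i, j)"
      using ij \<open>q \<le> d\<close> by (auto simp: toeplitz_def c0_def)
  qed (auto simp: toeplitz_def)
  ultimately show ?thesis
    using alg_indep_nonvanishing[OF c, of "\<lambda>c. det (?M c)" c0] by simp
qed

lemma inverse_of_det_nonzero:
  fixes A :: "'k::field mat"
  assumes "A \<in> carrier_mat N N" "det A \<noteq> 0"
  obtains B where "B \<in> carrier_mat N N" "A * B = 1\<^sub>m N" "B * A = 1\<^sub>m N"
  using det_non_zero_imp_unit[OF assms, of "()"] by (auto simp: Units_def ring_mat_def)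

section \<open>Spanning is inherited by generic forms\<close>

text \<open>
  A spanning family contains a basis, and the coefficient matrix of a basis is invertible. The minor has
  to be chosen among columns of the family itself, since arbitrary combinations of them would bring
  scalars from outside \<open>F\<close> into the determinant.
\<close>

lemma spanning_family_imp_nonzero_minor:
  fixes v :: "'q \<Rightarrow> (nat, 'k::field) mpoly"
  assumes e: "bij_betw e {0..<N} E"
    and v: "\<And>x. x \<in> Q \<Longrightarrow> keys (v x) \<subseteq> E"
    and span: "mon_poly ` E \<subseteq> vs.span (v ` Q)"
  obtains q where "\<And>j. q j \<in> Q \<or> N = 0"
    "det (mat N N (\<lambda>(i, j). lookup (v (q j)) (e i))) \<noteq> 0"
proof -
  have E: "finite E" "card E = N"
    using e bij_betw_finite[OF e] bij_betw_same_card[OF e] by auto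
  obtain b where b: "b \<subseteq> v ` Q" "vs.independent b" "v ` Q \<subseteq> vs.span b"
    using vs.maximal_independent_subset by blast
  have bE: "b \<subseteq> vs.span (mon_poly ` E)" using b(1) v by (auto simp: span_mon_poly)
  have Eb: "mon_poly ` E \<subseteq> vs.span b"
    using span b(3) vs.span_minimal[OF _ vs.subspace_span] by blast
  have cE: "card (mon_poly ` E :: (nat, 'k) mpoly set) = N"
    using E card_image[OF inj_on_subset[OF inj_mon_poly subset_UNIV]] by metis
  have fb: "finite b" "card b \<le> N"
    using vs.independent_span_bound[of "mon_poly ` E" b] E b(2) bE cE by auto
  have cb: "card b = N"
    using vs.independent_span_bound[OF fb(1) independent_mon_poly Eb] cE fb(2) by simp
  obtain h where h: "bij_betw h {0..<N} b"
    using ex_bij_betw_nat_finite[OF fb(1)] cb by auto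
  \<comment> \<open>The index \<open>q j\<close> is only meaningful for \<open>j < N\<close>; elsewhere any member of \<open>Q\<close> will do, which exists
    unless \<open>N = 0\<close>.\<close>
  define q where "q j = (SOME x. x \<in> Q \<and> (j < N \<longrightarrow> v x = h j))" for j
  have q: "q j \<in> Q \<and> (j < N \<longrightarrow> v (q j) = h j)" if "N \<noteq> 0" for j
  proof -
    have "h j' \<in> v ` Q" if "j' < N" for j' using h b(1) that bij_betwE by fastforce
    then have "\<exists>x. x \<in> Q \<and> (j < N \<longrightarrow> v x = h j)"
      using that by (cases "j < N") (fastforce, blast)
    then show ?thesis unfolding q_def by (rule someI_ex)
  qed
  let ?A = "mat N N (\<lambda>(i, j). lookup (v (q j)) (e i))"
  have "det ?A \<noteq> 0"
  proof
    assume "det ?A = 0"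
    then obtain w where w: "w \<in> carrier_vec N" "w \<noteq> 0\<^sub>v N" "?A *\<^sub>v w = 0\<^sub>v N"
      using det_0_iff_vec_prod_zero_field[of ?A N] by auto
    have "(\<Sum>j = 0..<N. scale (w $ j) (h j)) = 0"
    proof (rule poly_mapping_eqI)
      fix t
      have eq: "lookup (\<Sum>j = 0..<N. scale (w $ j) (h j)) t = (\<Sum>j = 0..<N. w $ j * lookup (v (q j)) t)"
        using q by (auto simp: lookup_sum intro!: sum.cong)
      show "lookup (\<Sum>j = 0..<N. scale (w $ j) (h j)) t = lookup 0 t"
      proof (cases "t \<in> E")
        case True
        then obtain i where i: "i < N" "t = e i" using e by (auto simp: bij_betw_def)
        have "(?A *\<^sub>v w) $ i = (\<Sum>j = 0..<N. lookup (v (q j)) t * w $ j)"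
          using i w(1) by (auto simp: scalar_prod_def intro!: sum.cong)
        then show ?thesis using w(3) i(1) by (simp add: eq mult.commute)
      next
        case False
        then have "lookup (v (q j)) t = 0" if "j < N" for j
          using v[of "q j"] q[of j] that by (auto simp: in_keys_iff)
        then show ?thesis by (simp add: eq)
      qed
    qed
    also have "(\<Sum>j = 0..<N. scale (w $ j) (h j)) =
        (\<Sum>x\<in>b. scale (w $ (the_inv_into {0..<N} h x)) x)"
      using h by (subst sum.reindex_bij_betw[OF h, symmetric])
        (auto intro!: sum.cong simp: the_inv_into_f_f bij_betw_def)
    finally have 0: "(\<Sum>x\<in>b. scale (w $ (the_inv_into {0..<N} h x)) x) = 0" .
    have "w $ j = 0" if "j < N" for j
    proof -
      have "h j \<in> b" using h that by (auto simp: bij_betw_def)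
      from vs.independentD[OF b(2) fb(1) order_refl 0 this] show ?thesis
        using h that by (simp add: the_inv_into_f_f bij_betw_def)
    qed
    then show False using w(1,2) by (auto intro: eq_vecI)
  qed
  then show ?thesis using that[of q] q by blast
qed

lemma nonzero_minor_imp_spanning:
  fixes u :: "nat \<Rightarrow> (nat, 'k::field) mpoly"
  assumes e: "bij_betw e {0..<N} E"
    and u: "\<And>j. j < N \<Longrightarrow> keys (u j) \<subseteq> E"
    and det: "det (mat N N (\<lambda>(i, j). lookup (u j) (e i))) \<noteq> 0"
  shows "mon_poly ` E \<subseteq> vs.span (u ` {0..<N})"
proof
  let ?A = "mat N N (\<lambda>(i, j). lookup (u j) (e i))"
  obtain B where B: "B \<in> carrier_mat N N" "?A * B = 1\<^sub>m N"
    using inverse_of_det_nonzero[of ?A N] det by auto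
  fix p :: "(nat, 'k) mpoly" assume "p \<in> mon_poly ` E"
  then obtain i where i: "i < N" "p = mon_poly (e i)" using e by (auto simp: bij_betw_def)
  have "p = (\<Sum>j = 0..<N. scale (B $$ (j, i)) (u j))"
  proof (rule poly_mapping_eqI)
    fix t
    show "lookup p t = lookup (\<Sum>j = 0..<N. scale (B $$ (j, i)) (u j)) t"
    proof (cases "t \<in> E")
      case True
      then obtain l where l: "l < N" "t = e l" using e by (auto simp: bij_betw_def)
      have "(?A * B) $$ (l, i) = (\<Sum>j = 0..<N. lookup (u j) t * B $$ (j, i))"
        using i l B(1) by (auto simp: scalar_prod_def intro!: sum.cong)
      moreover have "e l = e i \<longleftrightarrow> l = i"
        using e i l by (auto simp: bij_betw_def inj_on_def)
      ultimately show ?thesis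
        using i l B(2) by (simp add: lookup_mon_poly lookup_sum mult.commute)
    next
      case False
      moreover have "e i \<in> E" using e i by (auto simp: bij_betw_def)
      moreover have "lookup (u j) t = 0" if "j < N" for j
        using False u[OF that] by (auto simp: in_keys_iff)
      ultimately show ?thesis using i by (auto simp: lookup_mon_poly lookup_sum)
    qed
  qed
  moreover have "(\<Sum>j = 0..<N. scale (B $$ (j, i)) (u j)) \<in> vs.span (u ` {0..<N})"
    by (intro vs.span_sum vs.span_scale vs.span_base imageI)
  ultimately show "p \<in> vs.span (u ` {0..<N})" by simp
qed

definition cofactors :: "nat \<Rightarrow> (nat \<Rightarrow> nat) \<Rightarrow> nat \<Rightarrow> (nat \<times> nat mon) set" where
  "cofactors n d e = {(k, m). k \<in> {1..n} \<and> m \<in> monomials n \<and> mon_deg m + d k = e}"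

text \<open>
  The products of degree \<open>e\<close> of a form and a monomial. They span the part of degree \<open>e\<close> of the ideal
  generated by the forms (see \<open>hom_component_in_span_gens\<close> below).
\<close>

definition gens ::
  "nat \<Rightarrow> (nat \<Rightarrow> nat) \<Rightarrow> (nat \<Rightarrow> (nat, 'k::field) mpoly) \<Rightarrow> nat \<Rightarrow> (nat, 'k) mpoly set" where
  "gens n d f e = (\<lambda>(k, m). f k * mon_poly m) ` cofactors n d e"

definition forms_with_coeffs ::
  "nat \<Rightarrow> (nat \<Rightarrow> nat) \<Rightarrow> (nat \<times> nat mon \<Rightarrow> 'k::field) \<Rightarrow> nat \<Rightarrow> (nat, 'k) mpoly" where
  "forms_with_coeffs n d c k = (\<Sum>s\<in>monomials_deg n (d k). scale (c (k, s)) (mon_poly s))"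

lemma forms_with_own_coeffs:
  fixes p :: "(nat, 'k::field) mpoly"
  assumes "f k \<in> homogeneous_polys n (d k)"
  shows "forms_with_coeffs n d (\<lambda>(k, s). lookup (f k) s) k = f k"
proof -
  have "f k = (\<Sum>s\<in>keys (f k). scale (lookup (f k) s) (mon_poly s))" by (rule sum_monomials)
  also have "\<dots> = (\<Sum>s\<in>monomials_deg n (d k). scale (lookup (f k) s) (mon_poly s))"
    using assms by (intro sum.mono_neutral_left) (auto simp: homogeneous_polys_def in_keys_iff)
  finally show ?thesis by (simp add: forms_with_coeffs_def)
qed

lemma gens_homogeneous:
  assumes "\<And>k. k \<in> {1..n} \<Longrightarrow> f k \<in> homogeneous_polys n (d k)"
  shows "gens n d f e \<subseteq> homogeneous_polys n e"
proof
  fix p assume "p \<in> gens n d f e"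
  then obtain k m where km: "k \<in> {1..n}" "m \<in> monomials_deg n (mon_deg m)" "mon_deg m + d k = e" "p = f k * mon_poly m"
    by (auto simp: gens_def cofactors_def monomials_deg_def)
  then show "p \<in> homogeneous_polys n e"
    using homogeneous_mult[OF assms[OF km(1)] mon_poly_homogeneous[OF km(2)]] by (simp add: add.commute)
qed

text \<open>
  The polynomials in question are indexed by the same set for every choice of forms, and their
  coefficients are polynomial functions of the coefficients of the forms. A maximal minor that does not
  vanish for \<open>f0\<close> therefore does not vanish for \<open>f\<close> either.
\<close>

theorem span_gens_transfer:
  fixes F :: "'k::field set" and f f0 :: "nat \<Rightarrow> (nat, 'k) mpoly"
  assumes F: "subfield F (ring_of_type_algebra :: 'k ring)"
    and f: "generic_forms F n d f"
    and f0: "\<And>k. k \<in> {1..n} \<Longrightarrow> f0 k \<in> homogeneous_polys n (d k)"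
    and W: "W \<subseteq> monomials_deg n e"
    and span: "mon_poly ` monomials_deg n e \<subseteq> vs.span (gens n d f0 e \<union> mon_poly ` W)"
  shows "mon_poly ` monomials_deg n e \<subseteq> vs.span (gens n d f e \<union> mon_poly ` W)"
proof -
  define E where "E = monomials_deg n e"
  define N where "N = card E"
  define I where "I = (SIGMA k:{1..n}. monomials_deg n (d k))"
  define coeffs where "coeffs g = (\<lambda>(k, s). lookup (g k) s)" for g :: "nat \<Rightarrow> (nat, 'k) mpoly"
  define Q where "Q = cofactors n d e <+> W"
  define v where "v g = case_sum (\<lambda>(k, m). g k * mon_poly m) mon_poly" for g :: "nat \<Rightarrow> (nat, 'k) mpoly"
  have vQ: "v g ` Q = gens n d g e \<union> mon_poly ` W" for g
    by (simp add: v_def Q_def gens_def Plus_def image_Un image_image)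
  have homog: "\<And>k. k \<in> {1..n} \<Longrightarrow> f k \<in> homogeneous_polys n (d k)"
    and indep: "alg_indep_family F I (coeffs f)"
    using f by (auto simp: generic_forms_def I_def coeffs_def)
  have keys_v: "keys (v g x) \<subseteq> E" 
    if "\<And>k. k \<in> {1..n} \<Longrightarrow> g k \<in> homogeneous_polys n (d k)" "x \<in> Q" for g x
  proof -
    have "v g x \<in> gens n d g e \<union> mon_poly ` W" using vQ that(2) by blast
    then show ?thesis
      using gens_homogeneous[of n g d e] that(1) W by (auto simp: homogeneous_polys_def E_def)
  qed
  obtain h where h: "bij_betw h {0..<N} E"
    using ex_bij_betw_nat_finite[of E] by (auto simp: N_def E_def)
  obtain q where q: "\<And>j. q j \<in> Q \<or> N = 0"
    and det0: "det (mat N N (\<lambda>(i, j). lookup (v f0 (q j)) (h i))) \<noteq> 0"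
  proof (rule spanning_family_imp_nonzero_minor[OF h, of Q "v f0"])
    show "mon_poly ` E \<subseteq> vs.span (v f0 ` Q)" using span by (simp add: vQ E_def)
  qed (use keys_v[OF f0] in auto)
  let ?M = "\<lambda>c. mat N N (\<lambda>(i, j). lookup (v (forms_with_coeffs n d c) (q j)) (h i))"
  have M: "?M (coeffs g) = mat N N (\<lambda>(i, j). lookup (v g (q j)) (h i))"
    if g: "\<And>k. k \<in> {1..n} \<Longrightarrow> g k \<in> homogeneous_polys n (d k)" for g
  proof -
    have "v (forms_with_coeffs n d (coeffs g)) x = v g x" if "x \<in> Q" for x
      using that forms_with_own_coeffs[of g _ n d] g
      by (auto simp: v_def Q_def cofactors_def coeffs_def)
    then show ?thesis using q by (intro cong_mat) auto
  qed
  have "poly_fun F I (\<lambda>c. det (?M c))"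
  proof (rule poly_fun_det[OF F])
    fix i j assume ij: "i < N" "j < N"
    have "q j \<in> Q" using q[of j] ij by auto
    then consider k m where "q j = Inl (k, m)" "k \<in> {1..n}" | w where "q j = Inr w"
      by (auto simp: Q_def cofactors_def)
    then show "poly_fun F I (\<lambda>c. ?M c $$ (i, j))"
    proof cases
      case 1
      have "?M c $$ (i, j) = (\<Sum>s\<in>monomials_deg n (d k). c (k, s) * (if h i = s + m then 1 else 0))" for c
        using ij 1 by (simp add: v_def forms_with_coeffs_def sum_distrib_right scale_mult_left
            lookup_sum mon_poly_add[symmetric] lookup_mon_poly)
      then show ?thesis
        using 1(2) subfield_closed(1,2)[OF F]
        by (auto simp: I_def intro!: poly_fun_sum[OF F] poly_fun_mult[OF F] poly_fun_var[OF F] poly_fun_const[OF F])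
    next
      case 2
      then show ?thesis
        using ij subfield_closed(1,2)[OF F] by (auto simp: v_def lookup_mon_poly intro!: poly_fun_const[OF F])
    qed
  qed simp
  then have "det (?M (coeffs f)) \<noteq> 0"
    using alg_indep_nonvanishing[OF indep, of "\<lambda>c. det (?M c)" "coeffs f0"] det0 M[OF f0] by simp
  then have "det (mat N N (\<lambda>(i, j). lookup (v f (q j)) (h i))) \<noteq> 0" using M[OF homog] by simp
  then have "mon_poly ` E \<subseteq> vs.span ((\<lambda>j. v f (q j)) ` {0..<N})"
    using nonzero_minor_imp_spanning[OF h, of "\<lambda>j. v f (q j)"] keys_v[OF homog] q by fastforce
  also have "\<dots> \<subseteq> vs.span (v f ` Q)" using q by (intro vs.span_mono) fastforce
  finally show ?thesis by (simp add: vQ E_def)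
qed

section \<open>Surjectivity for forms in two neighbouring variables\<close>

text \<open>
  This is the case of two variables. Think of \<open>u l\<close> as \<open>y\<^sup>l x\<^bsup>s - l\<^esup>\<close> and of \<open>V\<close> as the part of degree \<open>s\<close>
  of the ideal generated by \<open>y\<^sup>m\<close>, \<open>x\<^sup>r\<close> and \<open>\<Sum>\<^sub>l a\<^sub>l y\<^sup>l x\<^bsup>d - l\<^esup>\<close>. Modulo \<open>V\<close> only the \<open>u l\<close> with
  \<open>s - r < l < m\<close> are unknown, and \<open>2 s + 2 = m + d + r\<close> leaves enough multiples of the third generator for
  a square system with a Toeplitz matrix.
\<close>

lemma toeplitz_system_solution:
  fixes u :: "nat \<Rightarrow> (nat, 'k::field) mpoly"
  assumes V: "vs.subspace V"
    and num: "2 * s + 2 = m + d + r"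
    and hi: "\<And>l. m \<le> l \<Longrightarrow> l \<le> s \<Longrightarrow> u l \<in> V"
    and lo: "\<And>l. l + r \<le> s \<Longrightarrow> u l \<in> V"
    and rel: "\<And>b. b + d \<le> s \<Longrightarrow> (\<Sum>l\<le>d. scale (a l) (u (b + l))) \<in> V"
    and det: "\<And>N q. q \<le> d \<Longrightarrow> det (toeplitz N q (\<lambda>l. if l \<le> d then a l else 0)) \<noteq> 0"
    and "l \<le> s"
  shows "u l \<in> V"
proof -
  define b0 b1 where "b0 = s + 1 - r" and "b1 = min m (s + 1)"
  have outside: "u x \<in> V" if "x \<le> s" "x < b0 \<or> b1 \<le> x" for x
    using that hi[of x] lo[of x] by (auto simp: b0_def b1_def)
  show ?thesis
  proof (cases "b0 \<le> l \<and> l < b1")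
    case False
    then show ?thesis using outside[of l] \<open>l \<le> s\<close> by auto
  next
    case True
    \<comment> \<open>There are \<open>N\<close> unknowns. The relation for \<open>b\<close> involves \<open>u b, \<dots>, u (b + d)\<close>; using the
      values \<open>b = b0 - q, \<dots>, b0 - q + N - 1\<close> puts \<open>a q\<close> on the diagonal, and this choice
      of \<open>q\<close> satisfies \<open>q \<le> d\<close>, \<open>q \<le> b0\<close> and keeps \<open>b + d \<le> s\<close>.\<close>
    define N q where "N = b1 - b0" and "q = min b0 d"
    let ?T = "toeplitz N q (\<lambda>l. if l \<le> d then a l else 0)"
    have col: "(\<Sum>i<N. scale (?T $$ (i, j)) (u (b0 + i))) \<in> V" if j: "j < N" for j
    proof -
      define b where "b = b0 - q + j"
      define g where "g x = scale (if b \<le> x \<and> x - b \<le> d then a (x - b) else 0) (u x)" for x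
      have "b + d \<le> s"
        using j num by (auto simp: b_def q_def N_def b0_def b1_def min_def split: if_splits)
      have "(\<Sum>l\<le>d. scale (a l) (u (b + l))) = (\<Sum>x\<in>{b..b+d}. g x)"
        by (rule sum.reindex_bij_witness[of _ "\<lambda>x. x - b" "\<lambda>l. b + l"]) (auto simp: g_def)
      also have "\<dots> = (\<Sum>x\<le>s. g x)"
        using \<open>b + d \<le> s\<close> by (intro sum.mono_neutral_left) (auto simp: g_def)
      also have "\<dots> = (\<Sum>x\<in>{b0..<b1}. g x) + (\<Sum>x\<in>{..s} - {b0..<b1}. g x)"
        by (subst sum.subset_diff[of "{b0..<b1}"]) (auto simp: b1_def add.commute)
      finally have "(\<Sum>x\<in>{b0..<b1}. g x) =
          (\<Sum>l\<le>d. scale (a l) (u (b + l))) - (\<Sum>x\<in>{..s} - {b0..<b1}. g x)"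
        by (simp add: algebra_simps)
      moreover have "(\<Sum>x\<in>{..s} - {b0..<b1}. g x) \<in> V"
        unfolding g_def by (intro vs.subspace_sum[OF V] vs.subspace_scale[OF V] outside) auto
      ultimately have "(\<Sum>x\<in>{b0..<b1}. g x) \<in> V"
        using rel[OF \<open>b + d \<le> s\<close>] vs.subspace_diff[OF V] by simp
      also have "(\<Sum>x\<in>{b0..<b1}. g x) = (\<Sum>i<N. g (b0 + i))"
        by (rule sum.reindex_bij_witness[of _ "\<lambda>i. b0 + i" "\<lambda>x. x - b0"]) (auto simp: N_def)
      also have "\<dots> = (\<Sum>i<N. scale (?T $$ (i, j)) (u (b0 + i)))"
      proof (rule sum.cong)
        fix i assume "i \<in> {..<N}"
        moreover have "b \<le> b0 + i \<longleftrightarrow> j \<le> q + i" "b0 + i - b = q + i - j"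
          by (auto simp: b_def q_def)
        ultimately show "g (b0 + i) = scale (?T $$ (i, j)) (u (b0 + i))"
          using j by (auto simp: g_def toeplitz_def)
      qed simp
      finally show ?thesis .
    qed
    have T: "?T \<in> carrier_mat N N" by (simp add: toeplitz_def)
    obtain B where B: "B \<in> carrier_mat N N" "?T * B = 1\<^sub>m N"
      using inverse_of_det_nonzero[OF T det[of q N]] by (auto simp: q_def)
    define l' where "l' = l - b0"
    have l': "l' < N" "l = b0 + l'" using True by (auto simp: l'_def N_def)
    have "(\<Sum>j<N. scale (B $$ (j, l')) (\<Sum>i<N. scale (?T $$ (i, j)) (u (b0 + i)))) =
        (\<Sum>i<N. scale (\<Sum>j<N. ?T $$ (i, j) * B $$ (j, l')) (u (b0 + i)))"
      by (simp add: vs.scale_sum_right vs.scale_sum_left mult.commute, rule sum.swap)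
    also have "\<dots> = (\<Sum>i<N. scale (if i = l' then 1 else 0) (u (b0 + i)))"
    proof (rule sum.cong)
      fix i assume i: "i \<in> {..<N}"
      have "(\<Sum>j<N. ?T $$ (i, j) * B $$ (j, l')) = (?T * B) $$ (i, l')"
        using i l'(1) B(1) T by (auto simp: scalar_prod_def lessThan_atLeast0 intro!: sum.cong)
      then show "scale (\<Sum>j<N. ?T $$ (i, j) * B $$ (j, l')) (u (b0 + i)) =
          scale (if i = l' then 1 else 0) (u (b0 + i))"
        using i l'(1) B(2) by simp
    qed simp
    also have "\<dots> = (\<Sum>i<N. if i = l' then u (b0 + i) else 0)"
      by (intro sum.cong) auto
    also have "\<dots> = u l" using l' by simp
    finally show ?thesis
      using col vs.subspace_sum[OF V] vs.subspace_scale[OF V]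
      by (metis (no_types, lifting) lessThan_iff)
  qed
qed

lemma span_gens_mult:
  assumes "p \<in> vs.span (gens n d f e)" "q \<in> homogeneous_polys n a"
  shows "q * p \<in> vs.span (gens n d f (a + e))"
proof (rule mult_span_subset[OF _ vs.subspace_span assms(1)])
  fix g assume "g \<in> gens n d f e"
  then obtain k m where km: "k \<in> {1..n}" "m \<in> monomials n" "mon_deg m + d k = e" "g = f k * mon_poly m"
    by (auto simp: gens_def cofactors_def)
  have "g * q \<in> vs.span (gens n d f (a + e))"
  proof (rule mult_span_subset[OF _ vs.subspace_span])
    show "q \<in> vs.span (mon_poly ` monomials_deg n a)"
      using assms(2) by (simp add: homogeneous_polys_eq_span)
    fix x :: "(nat, 'a) mpoly" assume "x \<in> mon_poly ` monomials_deg n a"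
    then obtain t where t: "t \<in> monomials n" "mon_deg t = a" "x = mon_poly t"
      by (auto simp: monomials_deg_def)
    have "(k, m + t) \<in> cofactors n d (a + e)"
      using km t by (auto simp: cofactors_def monomials_add mon_deg_add)
    moreover have "g * x = f k * mon_poly (m + t)"
      by (simp add: km(4) t(3) mon_poly_add mult.assoc)
    ultimately show "g * x \<in> vs.span (gens n d f (a + e))"
      by (intro vs.span_base) (force simp: gens_def)
  qed
  then show "q * g \<in> vs.span (gens n d f (a + e))" by (simp add: mult.commute)
qed

lemma form_in_span_gens:
  assumes "k \<in> {1..n}"
  shows "f k \<in> vs.span (gens n d f (d k))"
proof (rule vs.span_base)
  have "(k, 0) \<in> cofactors n d (d k)" using assms by (auto simp: cofactors_def monomials_def)
  then show "f k \<in> gens n d f (d k)" by (force simp: gens_def)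
qed

lemma gens_mono: "m \<le> n \<Longrightarrow> gens m d f e \<subseteq> gens n d f e"
  unfolding gens_def cofactors_def using monomials_mono[of m n] by fastforce

definition high_monomials :: "nat \<Rightarrow> nat \<Rightarrow> nat \<Rightarrow> nat mon set" where
  "high_monomials n e r = {u \<in> monomials_deg n e. r \<le> lookup u n}"

text \<open>
  If \<open>e + e' = \<Sum> d\<^sub>i - n\<close> with \<open>e' = e - r\<close>, the condition is that multiplication by the \<open>r\<close>-th power of
  the last variable maps degree \<open>e'\<close> onto degree \<open>e\<close> modulo the forms. It includes the
  case \<open>r > e\<close>: then there are no monomials with \<open>r \<le> lookup u n\<close>, and the condition is that the quotient
  vanishes in degree \<open>e\<close>.
\<close>

definition lefschetz :: "nat \<Rightarrow> (nat \<Rightarrow> nat) \<Rightarrow> (nat \<Rightarrow> (nat, 'k::field) mpoly) \<Rightarrow> bool" where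
  "lefschetz n d f \<longleftrightarrow> (\<forall>e r. 2 * e + n = (\<Sum>i=1..n. d i) + r \<longrightarrow>
     mon_poly ` monomials_deg n e \<subseteq> vs.span (gens n d f e \<union> mon_poly ` high_monomials n e r))"

lemma split_off_power:
  fixes u :: "'i mon"
  assumes "r \<le> lookup u n"
  shows "u = single n r + (u - single n r)"
  using assms by (intro poly_mapping_eqI) (auto simp: lookup_add lookup_minus lookup_single when_def)

lemma span_high_monomials:
  fixes p :: "(nat, 'k::field) mpoly"
  assumes "p \<in> vs.span (mon_poly ` high_monomials n e r)"
  shows "p = 0 \<or> (r \<le> e \<and> (\<exists>p'\<in>homogeneous_polys n (e - r). p = mon_poly (single n r) * p'))"
proof (cases "r \<le> e")
  case True
  let ?y = "mon_poly (single n r) :: (nat, 'k) mpoly"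
  let ?S = "(\<lambda>p. ?y * p) ` homogeneous_polys n (e - r)"
  have "vs.subspace ?S"
  proof (rule vs.subspaceI)
    show "0 \<in> ?S" using vs.subspace_0[OF subspace_homogeneous] by force
    fix a b assume "a \<in> ?S" "b \<in> ?S"
    then obtain a' b' where "a' \<in> homogeneous_polys n (e - r)" "b' \<in> homogeneous_polys n (e - r)"
      "a + b = ?y * (a' + b')" by (auto simp: distrib_left)
    then show "a + b \<in> ?S" using vs.subspace_add[OF subspace_homogeneous] by blast
  next
    fix c a assume "a \<in> ?S"
    then obtain a' where "a' \<in> homogeneous_polys n (e - r)" "scale c a = ?y * scale c a'"
      by (auto simp: scale_mult_right)
    then show "scale c a \<in> ?S" using vs.subspace_scale[OF subspace_homogeneous] by blast
  qed
  moreover have "mon_poly ` high_monomials n e r \<subseteq> ?S"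
  proof
    fix x :: "(nat, 'k) mpoly" assume "x \<in> mon_poly ` high_monomials n e r"
    then obtain u where u: "u \<in> monomials_deg n e" "r \<le> lookup u n" "x = mon_poly u"
      by (auto simp: high_monomials_def)
    define u' where "u' = u - single n r"
    have eq: "u = single n r + u'" unfolding u'_def by (rule split_off_power[OF u(2)])
    then have "u' \<in> monomials_deg n (e - r)"
      using u(1) monomials_addD[of "single n r" u' n] by (auto simp: monomials_deg_def mon_deg_add)
    then show "x \<in> ?S" using u(3) eq by (auto simp: mon_poly_add intro!: imageI mon_poly_homogeneous)
  qed
  ultimately show ?thesis using assms vs.span_minimal[of _ ?S] True by blast
next
  case False
  then have "high_monomials n e r = {}"
    by (auto simp: high_monomials_def monomials_deg_def) (metis le_trans lookup_le_mon_deg)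
  then show ?thesis using assms by simp
qed

text \<open>
  The exponent \<open>m\<close> is the length of a string that starts in degree \<open>e\<close> and is symmetric about half of
  \<open>\<Sum> d\<^sub>i - n\<close>.
\<close>

definition primitives ::
  "nat \<Rightarrow> (nat \<Rightarrow> nat) \<Rightarrow> (nat \<Rightarrow> (nat, 'k::field) mpoly) \<Rightarrow> nat \<Rightarrow> (nat, 'k) mpoly set" where
  "primitives n d f e = {w \<in> homogeneous_polys n e.
     \<exists>m. m + 2 * e + n = (\<Sum>i=1..n. d i) + 1 \<and>
         mon_poly (single n m) * w \<in> vs.span (gens n d f (m + e))}"

definition strings ::
  "nat \<Rightarrow> (nat \<Rightarrow> nat) \<Rightarrow> (nat \<Rightarrow> (nat, 'k::field) mpoly) \<Rightarrow> nat \<Rightarrow> (nat, 'k) mpoly set" where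
  "strings n d f e = {mon_poly (single n a) * w | a w e'. a + e' = e \<and> w \<in> primitives n d f e'}"

lemma single_power_homogeneous:
  "i \<in> {1..n} \<Longrightarrow> mon_poly (single i a) \<in> homogeneous_polys n a"
  by (intro mon_poly_homogeneous) (auto simp: monomials_deg_def single_in_monomials)

text \<open>
  The primitive decomposition known from the hard Lefschetz theorem, in the weak form that strings span.
  It needs only surjectivity: above the middle degree \<open>p\<close> is a multiple of a power of \<open>y\<close> modulo the ideal;
  below it, \<open>y\<^sup>m p\<close> is congruent to some \<open>y\<^bsup>m + 1\<^esup> p'\<close>, so that \<open>p - y p'\<close> is primitive.
\<close>

lemma lefschetz_decomposition:
  fixes f :: "nat \<Rightarrow> (nat, 'k::field) mpoly"
  assumes L: "lefschetz n d f" and "n \<ge> 1"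
  shows "homogeneous_polys n e \<subseteq> vs.span (gens n d f e \<union> strings n d f e)"
proof (induction e rule: less_induct)
  case (less e)
  define D where "D = (\<Sum>i=1..n. d i)"
  define y where "y a = (mon_poly (single n a) :: (nat, 'k) mpoly)" for a
  have yy: "y a * y b = y (a + b)" for a b
    by (simp add: y_def mon_poly_add[symmetric] single_add)
  have yH: "y a \<in> homogeneous_polys n a" for a
    using \<open>n \<ge> 1\<close> by (simp add: y_def single_power_homogeneous)
  note J_sub = subsetD[OF vs.span_mono[OF Un_upper1]]
  have shift: "y r * p \<in> vs.span (gens n d f (r + e') \<union> strings n d f (r + e'))"
    if "p \<in> vs.span (gens n d f e' \<union> strings n d f e')" for p r e'
  proof (rule mult_span_subset[OF _ vs.subspace_span that])
    fix x assume "x \<in> gens n d f e' \<union> strings n d f e'"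
    then show "y r * x \<in> vs.span (gens n d f (r + e') \<union> strings n d f (r + e'))"
    proof
      assume "x \<in> gens n d f e'"
      then show ?thesis using span_gens_mult[OF vs.span_base yH] J_sub by blast
    next
      assume "x \<in> strings n d f e'"
      then obtain a w e'' where w: "a + e'' = e'" "w \<in> primitives n d f e''" "x = y a * w"
        by (auto simp: strings_def y_def)
      then have "y r * x = y (r + a) * w" "r + a + e'' = r + e'"
        by (auto simp: yy mult.assoc[symmetric])
      then have "y r * x \<in> strings n d f (r + e')"
        using w(2) unfolding strings_def y_def by blast
      then show ?thesis by (intro vs.span_base) simp
    qed
  qed
  have split: "\<exists>g\<in>vs.span (gens n d f e'). p = g \<or>
      (r \<le> e' \<and> (\<exists>p'\<in>homogeneous_polys n (e' - r). p = g + y r * p'))"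
    if p: "p \<in> homogeneous_polys n e'" and num: "2 * e' + n = D + r" for p e' r
  proof -
    have "mon_poly ` monomials_deg n e' \<subseteq> vs.span (gens n d f e' \<union> mon_poly ` high_monomials n e' r)"
      using L num by (auto simp: lefschetz_def D_def)
    then have "p \<in> vs.span (gens n d f e' \<union> mon_poly ` high_monomials n e' r)"
      using p vs.span_minimal[OF _ vs.subspace_span] unfolding homogeneous_polys_eq_span by blast
    then obtain g h where "g \<in> vs.span (gens n d f e')"
      "h \<in> vs.span (mon_poly ` high_monomials n e' r)" "p = g + h"
      unfolding vs.span_Un by blast
    then show ?thesis using span_high_monomials[of h n e' r] by (auto simp: y_def)
  qed
  show ?case
  proof
    fix p :: "(nat, 'k) mpoly" assume p: "p \<in> homogeneous_polys n e"
    let ?V = "vs.span (gens n d f e \<union> strings n d f e)"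
    show "p \<in> ?V"
    proof (cases "2 * e + n > D")
      case True
      define r where "r = 2 * e + n - D"
      obtain g where g: "g \<in> vs.span (gens n d f e)"
        "p = g \<or> (r \<le> e \<and> (\<exists>p'\<in>homogeneous_polys n (e - r). p = g + y r * p'))"
        using split[OF p, of r] True by (auto simp: r_def)
      have gV: "g \<in> ?V" using g(1) J_sub by blast
      show ?thesis
      proof (cases "p = g")
        case False
        then obtain p' where p': "r \<le> e" "p' \<in> homogeneous_polys n (e - r)" "p = g + y r * p'"
          using g(2) by blast
        have "r > 0" using True by (simp add: r_def)
        then have "e - r < e" using p'(1) by linarith
        have "p' \<in> vs.span (gens n d f (e - r) \<union> strings n d f (e - r))"
          using less[OF \<open>e - r < e\<close>] p'(2) by blast
        from shift[OF this, of r] show ?thesis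
          using p' gV by (auto intro: vs.span_add)
      qed (use gV in simp)
    next
      case False
      define m where "m = D + 1 - n - 2 * e"
      have num: "m + 2 * e + n = D + 1" using False by (simp add: m_def)
      have "y m * p \<in> homogeneous_polys n (m + e)" by (rule homogeneous_mult[OF yH p])
      then obtain g where g: "g \<in> vs.span (gens n d f (m + e))"
        "y m * p = g \<or> (m + 1 \<le> m + e \<and>
          (\<exists>p'\<in>homogeneous_polys n (m + e - (m + 1)). y m * p = g + y (m + 1) * p'))"
        using split[of "y m * p" "m + e" "m + 1"] num by auto
      have prim: "w \<in> ?V" if "w \<in> homogeneous_polys n e" "y m * w = g" for w
      proof -
        have "w \<in> primitives n d f e"
          using that g(1) num unfolding primitives_def y_def D_def by blast
        then have "y 0 * w \<in> strings n d f e" unfolding strings_def y_def by fastforce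
        then show ?thesis by (intro vs.span_base) (simp add: y_def)
      qed
      show ?thesis
      proof (cases "y m * p = g")
        case True
        then show ?thesis using prim[OF p] by simp
      next
        case False
        then obtain p' where p': "1 \<le> e" "p' \<in> homogeneous_polys n (e - 1)" "y m * p = g + y (m + 1) * p'"
          using g(2) by auto
        have "y 1 * p' \<in> homogeneous_polys n (1 + (e - 1))" by (rule homogeneous_mult[OF yH p'(2)])
        then have "p - y 1 * p' \<in> homogeneous_polys n e"
          using p p'(1) vs.subspace_diff[OF subspace_homogeneous] by simp
        moreover have "y m * (p - y 1 * p') = g"
          using p'(3) yy[of m 1] by (simp add: right_diff_distrib mult.assoc[symmetric])
        ultimately have 1: "p - y 1 * p' \<in> ?V" by (rule prim)
        have "p' \<in> vs.span (gens n d f (e - 1) \<union> strings n d f (e - 1))"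
          using less[of "e - 1"] p' by auto
        from shift[OF this, of 1] have "y 1 * p' \<in> ?V" using p'(1) by simp
        from vs.span_add[OF 1 this] show ?thesis by simp
      qed
    qed
  qed
qed

definition two_var_form :: "nat \<Rightarrow> nat \<Rightarrow> (nat \<Rightarrow> 'k::field) \<Rightarrow> (nat, 'k) mpoly" where
  "two_var_form k e a = (\<Sum>l\<le>e. scale (a l) (mon_poly (single k l + single (Suc k) (e - l))))"

text \<open>
  The strings of the quotient in \<open>n\<close> variables generate the quotient in \<open>n + 1\<close> variables over
  \<open>K[y, x]\<close>, where \<open>y\<close> and \<open>x\<close> are the last two variables. Since every string is symmetric about the
  same degree, the claim for each of them is the two-variable case with the same form \<open>f (Suc n)\<close>.
\<close>

lemma lefschetz_step:
  fixes f :: "nat \<Rightarrow> (nat, 'k::field) mpoly"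
  assumes L: "lefschetz n d f" and "n \<ge> 1"
    and f: "f (Suc n) = two_var_form n (d (Suc n)) a"
    and det: "\<And>N q. q \<le> d (Suc n) \<Longrightarrow> det (toeplitz N q (\<lambda>l. if l \<le> d (Suc n) then a l else 0)) \<noteq> 0"
  shows "lefschetz (Suc n) d f"
  unfolding lefschetz_def
proof (intro allI impI)
  fix e r assume num: "2 * e + Suc n = (\<Sum>i=1..Suc n. d i) + r"
  define \<delta> where "\<delta> = d (Suc n)"
  define V where "V = vs.span (gens (Suc n) d f e \<union> mon_poly ` high_monomials (Suc n) e r)"
  have V: "vs.subspace V" unfolding V_def by (rule vs.subspace_span)
  define y x where "y l = (mon_poly (single n l) :: (nat, 'k) mpoly)"
    and "x l = (mon_poly (single (Suc n) l) :: (nat, 'k) mpoly)" for l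
  have yy: "y (b + c) = y b * y c" and xx: "x (b + c) = x b * x c" for b c
    by (simp_all add: y_def x_def mon_poly_add[symmetric] single_add)
  have yH: "y l \<in> homogeneous_polys (Suc n) l" and xH: "x l \<in> homogeneous_polys (Suc n) l" for l
    using \<open>n \<ge> 1\<close> by (auto simp: y_def x_def single_power_homogeneous)
  have J_V: "vs.span (gens (Suc n) d f e) \<subseteq> V"
    unfolding V_def by (rule vs.span_mono) simp
  have J_mono: "p \<in> vs.span (gens (Suc n) d f e')" if "p \<in> vs.span (gens n d f e')" for p e'
    using that vs.span_mono[OF gens_mono[of n "Suc n" d f e']] by auto
  have string: "x b * (y c * w) \<in> V" if w: "w \<in> primitives n d f e'" and e: "b + c + e' = e" for b c w e'
  proof -
    define s where "s = b + c"
    obtain m where m: "m + 2 * e' + n = (\<Sum>i=1..n. d i) + 1"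
      "y m * w \<in> vs.span (gens n d f (m + e'))"
      using w by (auto simp: primitives_def y_def)
    have wn: "w \<in> homogeneous_polys n e'" using w by (simp add: primitives_def)
    then have wH: "w \<in> homogeneous_polys (Suc n) e'" using homogeneous_mono[of n "Suc n"] by auto
    have "x (s - l) * (y l * w) \<in> V" if "l \<le> s" for l
    proof (rule toeplitz_system_solution[OF V, of s m \<delta> r "\<lambda>l. x (s - l) * (y l * w)" a])
      show "2 * s + 2 = m + \<delta> + r"
        using m(1) num e by (simp add: \<delta>_def s_def)
    next
      fix l assume l: "m \<le> l" "l \<le> s"
      have "x (s - l) * y (l - m) \<in> homogeneous_polys (Suc n) (s - l + (l - m))"
        by (intro homogeneous_mult xH yH)
      have deg: "s - l + (l - m) + (m + e') = e" using l e by (simp add: s_def)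
      from span_gens_mult[OF J_mono[OF m(2)] \<open>x (s - l) * y (l - m) \<in> _\<close>]
      have "x (s - l) * y (l - m) * (y m * w) \<in> vs.span (gens (Suc n) d f e)"
        unfolding deg .
      moreover have "y l = y (l - m) * y m" using l yy[of "l - m" m] by simp
      ultimately show "x (s - l) * (y l * w) \<in> V" using J_V by (auto simp: mult.assoc)
    next
      fix l assume l: "l + r \<le> s"
      have deg: "s - l + (l + e') = e" using l e by (simp add: s_def)
      have "x (s - l) * (y l * w) \<in> homogeneous_polys (Suc n) (s - l + (l + e'))"
        by (intro homogeneous_mult xH yH wH)
      then have "keys (x (s - l) * (y l * w)) \<subseteq> monomials_deg (Suc n) e"
        unfolding deg by (simp add: homogeneous_polys_def)
      moreover have "r \<le> lookup t (Suc n)" if t: "t \<in> keys (x (s - l) * (y l * w))" for t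
      proof -
        obtain t' where "t = single (Suc n) (s - l) + t'"
          using subsetD[OF Poly_Mapping.keys_mult t] by (auto simp: x_def)
        then show ?thesis using l by (simp add: lookup_add)
      qed
      ultimately have "x (s - l) * (y l * w) \<in> vs.span (mon_poly ` high_monomials (Suc n) e r)"
        by (auto simp: span_mon_poly high_monomials_def)
      then show "x (s - l) * (y l * w) \<in> V"
        unfolding V_def using vs.span_mono[OF Un_upper2] by blast
    next
      fix b' assume b': "b' + \<delta> \<le> s"
      have "f (Suc n) * (x (s - \<delta> - b') * (y b' * w)) =
          (\<Sum>l\<le>\<delta>. scale (a l) (y l * x (\<delta> - l) * (x (s - \<delta> - b') * (y b' * w))))"
        by (simp add: f two_var_form_def \<delta>_def sum_distrib_right scale_mult_left mon_poly_add x_def y_def)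
      also have "\<dots> = (\<Sum>l\<le>\<delta>. scale (a l) (x (s - (b' + l)) * (y (b' + l) * w)))"
      proof (intro sum.cong refl arg_cong[of _ _ "scale _"])
        fix l assume "l \<in> {..\<delta>}"
        then have "s - (b' + l) = (\<delta> - l) + (s - \<delta> - b')" using b' by auto
        then show "y l * x (\<delta> - l) * (x (s - \<delta> - b') * (y b' * w)) = x (s - (b' + l)) * (y (b' + l) * w)"
          by (simp add: xx yy mult_ac)
      qed
      finally have eq: "(\<Sum>l\<le>\<delta>. scale (a l) (x (s - (b' + l)) * (y (b' + l) * w))) =
          (x (s - \<delta> - b') * (y b' * w)) * f (Suc n)" by (simp add: mult.commute)
      have deg: "s - \<delta> - b' + (b' + e') + \<delta> = e" using b' e by (simp add: s_def)
      have "x (s - \<delta> - b') * (y b' * w) \<in> homogeneous_polys (Suc n) (s - \<delta> - b' + (b' + e'))"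
        by (intro homogeneous_mult xH yH wH)
      moreover have "f (Suc n) \<in> vs.span (gens (Suc n) d f \<delta>)"
        unfolding \<delta>_def by (rule form_in_span_gens) simp
      ultimately have "x (s - \<delta> - b') * (y b' * w) * f (Suc n) \<in> vs.span (gens (Suc n) d f e)"
        using span_gens_mult[of "f (Suc n)" "Suc n" d f \<delta>] unfolding deg[symmetric] by blast
      then show "(\<Sum>l\<le>\<delta>. scale (a l) (x (s - (b' + l)) * (y (b' + l) * w))) \<in> V"
        unfolding eq using J_V by blast
    qed (use det that in \<open>auto simp: \<delta>_def\<close>)
    from this[of c] show ?thesis by (simp add: s_def)
  qed
  show "mon_poly ` monomials_deg (Suc n) e
      \<subseteq> vs.span (gens (Suc n) d f e \<union> mon_poly ` high_monomials (Suc n) e r)"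
    unfolding V_def[symmetric]
  proof
    fix p :: "(nat, 'k) mpoly" assume "p \<in> mon_poly ` monomials_deg (Suc n) e"
    then obtain t where t: "t \<in> monomials (Suc n)" "mon_deg t = e" "p = mon_poly t"
      by (auto simp: monomials_deg_def)
    define b where "b = lookup t (Suc n)"
    define t' where "t' = t - single (Suc n) b"
    have eq: "t = single (Suc n) b + t'" unfolding t'_def by (rule split_off_power) (simp add: b_def)
    have "lookup t' (Suc n) = 0" by (simp add: t'_def b_def lookup_minus)
    moreover have "t' \<in> monomials (Suc n)" using t(1) eq monomials_addD by metis
    ultimately have "keys t' \<subseteq> {1..Suc n} - {Suc n}" by (auto simp: monomials_def in_keys_iff)
    then have "t' \<in> monomials n" by (auto simp: monomials_def atLeastAtMostSuc_conv)
    moreover have b: "mon_deg t' = e - b" "b \<le> e" using t(2) eq by (auto simp: mon_deg_add)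
    ultimately have "mon_poly t' \<in> homogeneous_polys n (e - b)"
      by (intro mon_poly_homogeneous) (simp add: monomials_deg_def)
    then have mem: "mon_poly t' \<in> vs.span (gens n d f (e - b) \<union> strings n d f (e - b))"
      using lefschetz_decomposition[OF L \<open>n \<ge> 1\<close>] by blast
    have "x b * z \<in> V" if z: "z \<in> gens n d f (e - b) \<union> strings n d f (e - b)" for z
      using z
    proof
      assume "z \<in> gens n d f (e - b)"
      then have "x b * z \<in> vs.span (gens (Suc n) d f (b + (e - b)))"
        by (intro span_gens_mult[OF J_mono xH] vs.span_base)
      then show ?thesis using J_V b(2) by auto
    next
      assume "z \<in> strings n d f (e - b)"
      then show ?thesis using string b(2) by (auto simp: strings_def y_def)
    qed
    from mult_span_subset[OF this V mem] have "x b * mon_poly t' \<in> V" .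
    then show "p \<in> V" using t(3) eq by (simp add: x_def mon_poly_add[symmetric])
  qed
qed

lemma lefschetz_one_variable:
  fixes f :: "nat \<Rightarrow> (nat, 'k::field) mpoly"
  assumes "f 1 = mon_poly (single 1 (d 1))"
  shows "lefschetz 1 d f"
  unfolding lefschetz_def
proof (intro allI impI subsetI)
  fix e r and p :: "(nat, 'k) mpoly"
  assume num: "2 * e + 1 = (\<Sum>i=1..1. d i) + r" and "p \<in> mon_poly ` monomials_deg 1 e"
  then obtain t where t: "t \<in> monomials 1" "mon_deg t = e" "p = mon_poly t"
    by (auto simp: monomials_deg_def)
  have te: "t = single 1 e"
  proof -
    have "keys t \<subseteq> {1}" using t(1) by (auto simp: monomials_def)
    then have "mon_deg t = lookup t 1" by (subst mon_deg_eq_sum[of "{1}"]) auto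
    then show ?thesis
      using t(2) \<open>keys t \<subseteq> {1}\<close>
      by (intro poly_mapping_eqI) (auto simp: lookup_single when_def in_keys_iff)
  qed
  show "p \<in> vs.span (gens 1 d f e \<union> mon_poly ` high_monomials 1 e r)"
  proof (cases "r \<le> e")
    case True
    then have "t \<in> high_monomials 1 e r" using t te by (auto simp: high_monomials_def monomials_deg_def)
    then show ?thesis using t(3) by (intro vs.span_base) auto
  next
    case False
    then have "d 1 \<le> e" using num by simp
    then have "(1, single 1 (e - d 1)) \<in> cofactors 1 d e"
      by (auto simp: cofactors_def single_in_monomials)
    moreover have "p = f 1 * mon_poly (single 1 (e - d 1))"
      using \<open>d 1 \<le> e\<close>
      by (simp only: t(3) te assms mon_poly_add[symmetric] single_add[symmetric] le_add_diff_inverse)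
    ultimately show ?thesis by (intro vs.span_base) (force simp: gens_def)
  qed
qed

theorem lefschetz_two_var_forms:
  fixes f :: "nat \<Rightarrow> (nat, 'k::field) mpoly"
  assumes "n \<ge> 1"
    and "f 1 = mon_poly (single 1 (d 1))"
    and "\<And>k. 1 \<le> k \<Longrightarrow> k < n \<Longrightarrow> f (Suc k) = two_var_form k (d (Suc k)) (a k)"
    and "\<And>k N q. 1 \<le> k \<Longrightarrow> k < n \<Longrightarrow> q \<le> d (Suc k) \<Longrightarrow>
      det (toeplitz N q (\<lambda>l. if l \<le> d (Suc k) then a k l else 0)) \<noteq> 0"
  shows "lefschetz n d f"
  using assms
proof (induction n rule: nat_induct_at_least)
  case base
  then show ?case by (intro lefschetz_one_variable)
next
  case (Suc n)
  show ?case
  proof (rule lefschetz_step[OF Suc.IH])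
    show "f (Suc n) = two_var_form n (d (Suc n)) (a n)" using Suc.prems(2)[of n] Suc.hyps by simp
    show "det (toeplitz N q (\<lambda>l. if l \<le> d (Suc n) then a n l else 0)) \<noteq> 0" if "q \<le> d (Suc n)" for N q
      using Suc.prems(3)[of n q N] Suc.hyps that by simp
  qed (use Suc in auto)
qed

section \<open>Generic forms\<close>

definition reduced_monomials :: "nat \<Rightarrow> (nat \<Rightarrow> nat) \<Rightarrow> nat \<Rightarrow> nat mon set" where
  "reduced_monomials n d e = {t \<in> monomials_deg n e. \<forall>i\<in>{1..n}. lookup t i < d i}"

lemma two_var_form_homogeneous:
  "1 \<le> k \<Longrightarrow> Suc k \<le> n \<Longrightarrow> two_var_form k e a \<in> homogeneous_polys n e"
  unfolding two_var_form_def homogeneous_polys_eq_span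
  by (intro vs.span_sum vs.span_scale vs.span_base imageI)
    (auto simp: monomials_deg_def mon_deg_add intro!: monomials_add single_in_monomials)

context
  fixes F :: "'k::field set" and n :: nat and d and f :: "nat \<Rightarrow> (nat, 'k) mpoly"
  assumes F: "subfield F (ring_of_type_algebra :: 'k ring)" and f: "generic_forms F n d f"
begin

text \<open>
  For the forms \<open>x\<^sub>k\<close> to the power \<open>d\<^sub>k\<close>, every monomial is reduced or a multiple of a form.
\<close>

lemma generic_reduced_spanning:
  "mon_poly ` monomials_deg n e \<subseteq> vs.span (gens n d f e \<union> mon_poly ` reduced_monomials n d e)"
proof (rule span_gens_transfer[OF F f, of "\<lambda>k. mon_poly (single k (d k))"])
  let ?f0 = "\<lambda>k. mon_poly (single k (d k)) :: (nat, 'k) mpoly"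
  show "mon_poly ` monomials_deg n e \<subseteq>
      vs.span (gens n d ?f0 e \<union> mon_poly ` reduced_monomials n d e)"
  proof
    fix p :: "(nat, 'k) mpoly" assume "p \<in> mon_poly ` monomials_deg n e"
    then obtain t where t: "t \<in> monomials_deg n e" "p = mon_poly t" by auto
    show "p \<in> vs.span (gens n d ?f0 e \<union> mon_poly ` reduced_monomials n d e)"
    proof (cases "t \<in> reduced_monomials n d e")
      case False
      then obtain k where k: "k \<in> {1..n}" "d k \<le> lookup t k"
        using t(1) by (auto simp: reduced_monomials_def not_less)
      define m where "m = t - single k (d k)"
      have eq: "t = single k (d k) + m" unfolding m_def by (rule split_off_power[OF k(2)])
      then have "(k, m) \<in> cofactors n d e"
        using t(1) k(1) monomials_addD[of "single k (d k)" m n]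
        by (auto simp: cofactors_def monomials_deg_def mon_deg_add)
      moreover have "p = ?f0 k * mon_poly m" using t(2) eq mon_poly_add by metis
      ultimately show ?thesis by (intro vs.span_base) (force simp: gens_def)
    qed (use t(2) in \<open>auto intro: vs.span_base\<close>)
  qed
qed (auto simp: reduced_monomials_def single_power_homogeneous)

text \<open>
  The coefficients of the two-variable forms have to make all Toeplitz determinants nonzero at once. Taking
  them from the generic forms themselves achieves this, because they are algebraically independent.
\<close>

lemma generic_lefschetz:
  assumes "n \<ge> 1"
  shows "lefschetz n d f"
proof -
  let ?I = "SIGMA i:{1..n}. monomials_deg n (d i)"
  let ?c = "\<lambda>(i, t). lookup (f i) t"
  define \<phi> where "\<phi> k l = (Suc k, single k l + single (Suc k) (d (Suc k) - l) :: nat mon)" for k l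
  define a where "a k l = ?c (\<phi> k l)" for k l
  define f0 where "f0 k = (if k = 1 then mon_poly (single 1 (d 1))
     else two_var_form (k - 1) (d k) (a (k - 1)))" for k
  have c: "alg_indep_family F ?I ?c" using f by (simp add: generic_forms_def)
  have L: "lefschetz n d f0"
  proof (rule lefschetz_two_var_forms[OF assms, of f0 d a])
    fix k N q assume k: "1 \<le> k" "k < n" "q \<le> d (Suc k)"
    have "inj_on (\<phi> k) {..d (Suc k)}"
    proof (rule inj_onI)
      fix l l' assume "\<phi> k l = \<phi> k l'"
      then have "lookup (snd (\<phi> k l)) k = lookup (snd (\<phi> k l')) k" by simp
      then show "l = l'" by (simp add: \<phi>_def lookup_add lookup_single)
    qed
    moreover have "\<phi> k ` {..d (Suc k)} \<subseteq> ?I"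
      using k by (auto simp: \<phi>_def monomials_deg_def mon_deg_add intro!: monomials_add single_in_monomials)
    ultimately show "det (toeplitz N q (\<lambda>l. if l \<le> d (Suc k) then a k l else 0)) \<noteq> 0"
      unfolding a_def by (rule det_toeplitz_nonzero[OF F c _ _ k(3)])
  qed (auto simp: f0_def)
  have f0: "f0 k \<in> homogeneous_polys n (d k)" if "k \<in> {1..n}" for k
  proof (cases "k = 1")
    case False
    then have "1 \<le> k - 1" "Suc (k - 1) \<le> n" using that by auto
    from two_var_form_homogeneous[OF this, of "d k"] show ?thesis using False by (simp add: f0_def)
  qed (use that in \<open>simp add: f0_def single_power_homogeneous\<close>)
  show ?thesis
    unfolding lefschetz_def
  proof (intro allI impI)
    fix e r assume "2 * e + n = (\<Sum>i=1..n. d i) + r"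
    then show "mon_poly ` monomials_deg n e \<subseteq>
        vs.span (gens n d f e \<union> mon_poly ` high_monomials n e r)"
      using L by (intro span_gens_transfer[OF F f f0]) (auto simp: lefschetz_def high_monomials_def)
  qed
qed

end

section \<open>The Hilbert function of the quotient\<close>

lemma mon_poly_eq_prod:
  assumes "t \<in> monomials n"
  shows "mon_poly t = (\<Prod>i\<in>{1..n}. mon_poly (single i (lookup t i)))"
proof -
  have "mon_poly (\<Sum>i\<in>A. single i (lookup t i)) = (\<Prod>i\<in>A. mon_poly (single i (lookup t i)))" for A
    by (induction A rule: infinite_finite_induct) (auto simp: mon_poly_add)
  moreover have "(\<Sum>i\<in>{1..n}. single i (lookup t i)) = t"
    using assms by (intro poly_mapping_eqI)
      (auto simp: lookup_sum lookup_single when_def monomials_def in_keys_iff)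
  ultimately show ?thesis by metis
qed

context
  fixes n :: nat and d and f :: "nat \<Rightarrow> (nat, 'k::field) mpoly"
  assumes d: "\<And>i. i \<in> {1..n} \<Longrightarrow> d i \<ge> 1"
    and reduced_spanning: "\<And>e. mon_poly ` monomials_deg n e
      \<subseteq> vs.span (gens n d f e \<union> mon_poly ` reduced_monomials n d e)"
begin

text \<open>
  The product \<open>x\<^sup>\<alpha> f\<^sup>\<beta>\<close> belonging to the monomial with exponents \<open>\<alpha>\<^sub>i + d\<^sub>i \<beta>\<^sub>i\<close>, \<open>\<alpha>\<^sub>i < d\<^sub>i\<close>. Indexing these
  products by monomials makes it obvious how many of them there are in each degree.
\<close>

definition mixed_product :: "nat mon \<Rightarrow> (nat, 'k) mpoly" where
  "mixed_product t = (\<Prod>i\<in>{1..n}. mon_poly (single i (lookup t i mod d i)) * f i ^ (lookup t i div d i))"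

lemma mixed_product_reduced:
  assumes "t \<in> reduced_monomials n d e"
  shows "mixed_product t = mon_poly t"
proof -
  have "mixed_product t = (\<Prod>i\<in>{1..n}. mon_poly (single i (lookup t i)))"
    unfolding mixed_product_def using assms by (intro prod.cong) (auto simp: reduced_monomials_def)
  then show ?thesis
    using assms by (simp add: mon_poly_eq_prod[of t n] reduced_monomials_def monomials_deg_def)
qed

lemma form_mult_mixed_product:
  assumes "k \<in> {1..n}"
  shows "f k * mixed_product t = mixed_product (t + single k (d k))"
proof -
  let ?g = "\<lambda>t i. mon_poly (single i (lookup t i mod d i)) * f i ^ (lookup t i div d i)"
  have "?g (t + single k (d k)) k = f k * ?g t k"
    using d[OF assms] by (simp add: lookup_add mult.left_commute)
  moreover have "?g (t + single k (d k)) i = ?g t i" if "i \<noteq> k" for i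
    using that by (simp add: lookup_add lookup_single)
  ultimately show ?thesis
    using assms by (simp add: mixed_product_def prod.remove[of _ k] mult.assoc)
qed

lemma gens_subset_span_mixed:
  assumes "\<And>e'. e' < e \<Longrightarrow> mon_poly ` monomials_deg n e' \<subseteq> vs.span (mixed_product ` monomials_deg n e')"
  shows "gens n d f e \<subseteq> vs.span (mixed_product ` (monomials_deg n e - reduced_monomials n d e))"
proof
  fix g assume "g \<in> gens n d f e"
  then obtain k m where km: "k \<in> {1..n}" "m \<in> monomials n" "mon_deg m + d k = e" "g = f k * mon_poly m"
    by (auto simp: gens_def cofactors_def)
  have "mon_deg m < e" using km(3) d[OF km(1)] by simp
  then have "mon_poly m \<in> vs.span (mixed_product ` monomials_deg n (mon_deg m))"
    using assms[of "mon_deg m"] km(2) by (auto simp: monomials_deg_def)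
  then have "f k * mon_poly m \<in> vs.span (mixed_product ` (monomials_deg n e - reduced_monomials n d e))"
  proof (rule mult_span_subset[OF _ vs.subspace_span, rotated])
    fix x assume "x \<in> mixed_product ` monomials_deg n (mon_deg m)"
    then obtain s where s: "s \<in> monomials_deg n (mon_deg m)" "x = mixed_product s" by auto
    let ?t = "s + single k (d k)"
    have "?t \<in> monomials_deg n e"
      using s(1) km by (auto simp: monomials_deg_def mon_deg_add intro!: monomials_add single_in_monomials)
    moreover have "?t \<notin> reduced_monomials n d e"
      using km(1) by (auto simp: reduced_monomials_def lookup_add intro!: bexI[of _ k])
    ultimately show "f k * x \<in> vs.span (mixed_product ` (monomials_deg n e - reduced_monomials n d e))"
      unfolding s(2) form_mult_mixed_product[OF km(1)] by (intro vs.span_base imageI) simp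
  qed
  then show "g \<in> vs.span (mixed_product ` (monomials_deg n e - reduced_monomials n d e))"
    by (simp add: km(4))
qed

text \<open>
  Reduce modulo the ideal to reduced monomials, and expand the cofactors of the forms by induction on the
  degree.
\<close>

lemma mixed_products_spanning:
  "mon_poly ` monomials_deg n e \<subseteq> vs.span (mixed_product ` monomials_deg n e)"
proof (induction e rule: less_induct)
  case (less e)
  let ?V = "vs.span (mixed_product ` monomials_deg n e)"
  have "gens n d f e \<subseteq> ?V"
    using gens_subset_span_mixed[of e] less
      vs.span_mono[of "mixed_product ` (monomials_deg n e - reduced_monomials n d e)"
        "mixed_product ` monomials_deg n e"] by blast
  moreover have "mon_poly ` reduced_monomials n d e \<subseteq> ?V"
  proof
    fix p :: "(nat, 'k) mpoly" assume "p \<in> mon_poly ` reduced_monomials n d e"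
    then obtain t where "t \<in> reduced_monomials n d e" "p = mixed_product t"
      using mixed_product_reduced by auto
    then show "p \<in> ?V" by (intro vs.span_base) (auto simp: reduced_monomials_def)
  qed
  ultimately have "vs.span (gens n d f e \<union> mon_poly ` reduced_monomials n d e) \<subseteq> ?V"
    by (intro vs.span_minimal vs.subspace_span) simp
  then show ?case using reduced_spanning by blast
qed

text \<open>
  The mixed products of degree \<open>e\<close> span all forms of degree \<open>e\<close> and are at most as many as the monomials,
  so they form a basis. In this basis the reduced monomials and the ideal occupy disjoint sets of
  basis vectors.
\<close>

lemma reduced_independent_mod:
  "vs.span (mon_poly ` reduced_monomials n d e) \<inter> vs.span (gens n d f e) \<subseteq> {0}"
proof -
  let ?E = "monomials_deg n e" and ?M = "reduced_monomials n d e"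
  have card: "card (mon_poly ` ?E :: (nat, 'k) mpoly set) = card ?E"
    by (rule card_image) (rule inj_on_subset[OF inj_mon_poly subset_UNIV])
  have "card (mixed_product ` ?E) \<le> card ?E" by (rule card_image_le) simp
  then have ind: "vs.independent (mixed_product ` ?E)"
    using card by (intro vs.spanning_card_le_imp_independent[OF independent_mon_poly _ mixed_products_spanning]) auto
  have "card ?E \<le> card (mixed_product ` ?E)"
    using vs.independent_span_bound[OF _ independent_mon_poly mixed_products_spanning, of e] card by simp
  then have inj: "inj_on mixed_product ?E"
    using card_image_le[of ?E mixed_product] by (intro eq_card_imp_inj_on) auto
  have "mixed_product ` ?M \<inter> mixed_product ` (?E - ?M) = {}"
    using inj by (auto simp: inj_on_def reduced_monomials_def)
  then have "vs.span (mixed_product ` ?M) \<inter> vs.span (mixed_product ` (?E - ?M)) \<subseteq> {0}"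
    by (intro vs.independent_span_Int[OF ind]) (auto simp: reduced_monomials_def)
  moreover have "mixed_product ` ?M = mon_poly ` ?M"
    using mixed_product_reduced by (intro image_cong) auto
  moreover have "vs.span (gens n d f e) \<subseteq> vs.span (mixed_product ` (?E - ?M))"
    by (intro vs.span_minimal gens_subset_span_mixed mixed_products_spanning vs.subspace_span)
  ultimately show ?thesis by auto
qed

end

lemma lookup_outside_monomials: "t \<in> monomials n \<Longrightarrow> i \<notin> {1..n} \<Longrightarrow> lookup t i = 0"
  by (auto simp: monomials_def in_keys_iff)

lemma sum_pred:
  assumes "\<And>i. i \<in> {1..n} \<Longrightarrow> d i \<ge> (1::nat)"
  shows "(\<Sum>i\<in>{1..n}. d i - 1) + n = (\<Sum>i=1..n. d i)"
  using assms by (subst sum_subtractf_nat) (auto simp: sum_bounded_below[of "{1..n}" 1 d, simplified])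

lemma reduced_monomials_empty:
  assumes "\<And>i. i \<in> {1..n} \<Longrightarrow> d i \<ge> 1" "e > (\<Sum>i=1..n. d i) - n"
  shows "reduced_monomials n d e = {}"
proof (rule equals0I)
  fix t assume t: "t \<in> reduced_monomials n d e"
  then have "mon_deg t = (\<Sum>i\<in>{1..n}. lookup t i)"
    by (intro mon_deg_eq_sum) (auto simp: reduced_monomials_def monomials_deg_def monomials_def)
  also have "\<dots> \<le> (\<Sum>i\<in>{1..n}. d i - 1)"
    using t by (intro sum_mono) (force simp: reduced_monomials_def)
  finally show False
    using t assms(2) sum_pred[of n d, OF assms(1)] by (simp add: reduced_monomials_def monomials_deg_def)
qed

text \<open>
  Replace each exponent \<open>t\<^sub>i\<close> by \<open>d\<^sub>i - 1 - t\<^sub>i\<close>.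
\<close>

lemma card_reduced_le:
  assumes d: "\<And>i. i \<in> {1..n} \<Longrightarrow> d i \<ge> 1" and e: "e + e' + n = (\<Sum>i=1..n. d i)"
  shows "card (reduced_monomials n d e) \<le> card (reduced_monomials n d e')"
proof -
  define h where "h t = (\<Sum>i\<in>{1..n}. single i (d i - 1 - lookup t i))" for t :: "nat mon"
  have lh: "lookup (h t) i = (if i \<in> {1..n} then d i - 1 - lookup t i else 0)" for t i
    by (simp add: h_def lookup_sum lookup_single when_def)
  have "inj_on h (reduced_monomials n d e)"
  proof (rule inj_onI)
    fix s t assume st: "s \<in> reduced_monomials n d e" "t \<in> reduced_monomials n d e" "h s = h t"
    show "s = t"
    proof (rule poly_mapping_eqI)
      fix i
      show "lookup s i = lookup t i"
      proof (cases "i \<in> {1..n}")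
        case True
        then have "lookup s i < d i" "lookup t i < d i" using st by (auto simp: reduced_monomials_def)
        moreover have "d i - 1 - lookup s i = d i - 1 - lookup t i"
          using arg_cong[OF st(3), of "\<lambda>t. lookup t i"] True by (simp add: lh)
        ultimately show ?thesis by linarith
      next
        case False
        then show ?thesis
          using st lookup_outside_monomials[OF _ False]
          by (simp add: reduced_monomials_def monomials_deg_def)
      qed
    qed
  qed
  moreover have "h ` reduced_monomials n d e \<subseteq> reduced_monomials n d e'"
  proof safe
    fix t assume t: "t \<in> reduced_monomials n d e"
    have k: "keys (h t) \<subseteq> {1..n}" by (auto simp: in_keys_iff lh split: if_splits)
    have "mon_deg (h t) + mon_deg t = (\<Sum>i\<in>{1..n}. lookup (h t) i) + (\<Sum>i\<in>{1..n}. lookup t i)"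
      using t k mon_deg_eq_sum[of "{1..n}" "h t"] mon_deg_eq_sum[of "{1..n}" t]
      by (simp add: reduced_monomials_def monomials_deg_def monomials_def)
    also have "\<dots> = (\<Sum>i\<in>{1..n}. d i - 1)"
      unfolding sum.distrib[symmetric] using t by (intro sum.cong) (force simp: lh reduced_monomials_def)+
    finally have "mon_deg (h t) = e'"
      using sum_pred[of n d, OF d] e t by (simp add: reduced_monomials_def monomials_deg_def)
    moreover have "lookup (h t) i < d i" if "i \<in> {1..n}" for i
      using that d[OF that] by (simp add: lh)
    ultimately show "h t \<in> reduced_monomials n d e'"
      using k by (simp add: reduced_monomials_def monomials_deg_def monomials_def)
  qed
  ultimately show ?thesis
    by (rule card_inj_on_le) (simp add: reduced_monomials_def)
qed

section \<open>The graded reverse lexicographic order\<close>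

lemma grevlex_irrefl: "\<not> grevlex_less t t"
  by (simp add: grevlex_less_def)

lemma grevlex_trans:
  assumes "grevlex_less s t" "grevlex_less t u"
  shows "grevlex_less s u"
proof (cases "mon_deg s < mon_deg u")
  case False
  then have deg: "mon_deg s = mon_deg t" "mon_deg t = mon_deg u"
    using assms by (auto simp: grevlex_less_def)
  then obtain i j where
    i: "lookup s i > lookup t i" "\<And>k. k > i \<Longrightarrow> lookup s k = lookup t k" and
    j: "lookup t j > lookup u j" "\<And>k. k > j \<Longrightarrow> lookup t k = lookup u k"
    using assms by (auto simp: grevlex_less_def)
  have "lookup s (max i j) > lookup u (max i j)"
    using i j by (cases i j rule: linorder_cases) (auto simp: max_def)
  moreover have "lookup s k = lookup u k" if "k > max i j" for k
    using i(2) j(2) that by simp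
  ultimately show ?thesis using deg by (auto simp: grevlex_less_def)
qed (simp add: grevlex_less_def)

lemma grevlex_asym: "grevlex_less s t \<Longrightarrow> \<not> grevlex_less t s"
  using grevlex_trans grevlex_irrefl by blast

lemma grevlex_total:
  assumes "s \<noteq> t"
  shows "grevlex_less s t \<or> grevlex_less t s"
proof (cases "mon_deg s = mon_deg t")
  case True
  define N where "N = {i. lookup s i \<noteq> lookup t i}"
  have "N \<subseteq> keys s \<union> keys t" by (auto simp: N_def in_keys_iff)
  then have fin: "finite N" by (rule finite_subset) simp
  have "N \<noteq> {}"
  proof
    assume "N = {}"
    then have "lookup s i = lookup t i" for i by (simp add: N_def)
    then show False using assms poly_mapping_eqI by blast
  qed
  then have "Max N \<in> N" using fin by (rule Max_in[rotated])
  then have "lookup s (Max N) < lookup t (Max N) \<or> lookup t (Max N) < lookup s (Max N)"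
    by (simp add: N_def neq_iff)
  moreover have "lookup s k = lookup t k" if "k > Max N" for k
    using Max_ge[OF fin, of k] that by (fastforce simp: N_def)
  ultimately show ?thesis
    unfolding grevlex_less_def using True by metis
qed (auto simp: grevlex_less_def)

lemma grevlex_add_left: "grevlex_less s t \<Longrightarrow> grevlex_less (u + s) (u + t)"
  by (auto simp: grevlex_less_def mon_deg_add lookup_add)

text \<open>
  The property of the graded reverse lexicographic order that makes it compatible with multiplication by
  powers of the last variable.
\<close>

lemma grevlex_last_exponent:
  assumes "s \<in> monomials_deg n e" "t \<in> monomials_deg n e"
  shows "lookup s n > lookup t n \<Longrightarrow> grevlex_less s t" 
    and "grevlex_less s t \<Longrightarrow> lookup s n \<ge> lookup t n"
proof -
  have above: "lookup s k = lookup t k" if "k > n" for k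
    using assms that lookup_outside_monomials[of _ n k] by (auto simp: monomials_deg_def)
  show "grevlex_less s t" if "lookup s n > lookup t n"
    using that assms above by (auto simp: grevlex_less_def monomials_deg_def intro!: exI[of _ n])
  assume "grevlex_less s t"
  then obtain i where i: "lookup s i > lookup t i" "\<And>k. k > i \<Longrightarrow> lookup s k = lookup t k"
    using assms by (auto simp: grevlex_less_def monomials_deg_def)
  then show "lookup s n \<ge> lookup t n"
    using i(2)[of n] above by (cases i n rule: linorder_cases) auto
qed

lemma grevlex_greatest:
  assumes "finite A" "A \<noteq> {}"
  shows "\<exists>t\<in>A. \<forall>s\<in>A. s \<noteq> t \<longrightarrow> grevlex_less s t"
  using grevlex_trans grevlex_total
  by (intro Finite_Set.bex_greatest_element[OF assms]) (auto simp: transp_on_def totalp_on_def)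

lemma grevlex_least:
  assumes "finite A" "A \<noteq> {}"
  shows "\<exists>t\<in>A. \<forall>s\<in>A. s \<noteq> t \<longrightarrow> grevlex_less t s"
  using grevlex_trans grevlex_total
  by (intro Finite_Set.bex_least_element[OF assms]) (auto simp: transp_on_def totalp_on_def)

lemma lead_monI:
  assumes "t \<in> keys p" "\<And>s. s \<in> keys p \<Longrightarrow> s \<noteq> t \<Longrightarrow> grevlex_less s t"
  shows "lead_mon p = t"
  unfolding lead_mon_def
proof (rule the_equality)
  show "t \<in> keys p \<and> (\<forall>s\<in>keys p. s \<noteq> t \<longrightarrow> grevlex_less s t)" using assms by blast
  fix t' assume t': "t' \<in> keys p \<and> (\<forall>s\<in>keys p. s \<noteq> t' \<longrightarrow> grevlex_less s t')"
  show "t' = t"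
  proof (rule ccontr)
    assume "t' \<noteq> t"
    then have "grevlex_less t' t" "grevlex_less t t'" using assms t' by auto
    then show False using grevlex_asym by blast
  qed
qed

lemma lead_mon:
  assumes "p \<noteq> 0"
  shows "lead_mon p \<in> keys p" "\<And>s. s \<in> keys p \<Longrightarrow> s \<noteq> lead_mon p \<Longrightarrow> grevlex_less s (lead_mon p)"
proof -
  have "finite (keys p)" "keys p \<noteq> {}"
    using assms by auto
  from grevlex_greatest[OF this] obtain t where
    t: "t \<in> keys p" "\<And>s. s \<in> keys p \<Longrightarrow> s \<noteq> t \<Longrightarrow> grevlex_less s t" by auto
  then have eq: "lead_mon p = t" by (rule lead_monI)
  show "lead_mon p \<in> keys p" using t(1) eq by simp
  show "grevlex_less s (lead_mon p)" if "s \<in> keys p" "s \<noteq> lead_mon p" for s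
    using t(2)[of s] that eq by simp
qed

lemma lookup_mon_poly_mult: "lookup (mon_poly u * p) (u + s) = lookup p s"
proof -
  have "mon_poly u * p = (\<Sum>t\<in>keys p. single (u + t) (lookup p t))"
    unfolding mult_eq_sum_singles[of "mon_poly u" p] by (simp add: lookup_mon_poly)
  then show ?thesis by (simp add: lookup_sum lookup_single when_def in_keys_iff)
qed

lemma keys_mon_poly_mult: "keys (mon_poly u * p) = (+) u ` keys p"
proof
  show "keys (mon_poly u * p) \<subseteq> (+) u ` keys p"
    using Poly_Mapping.keys_mult[of "mon_poly u" p] by auto
  show "(+) u ` keys p \<subseteq> keys (mon_poly u * p)"
    by (auto simp: in_keys_iff lookup_mon_poly_mult)
qed

lemma mon_poly_nonzero [simp]: "mon_poly u \<noteq> (0 :: (nat, 'k::field) mpoly)"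
  using keys_mon_poly[of u, where 'k = 'k] by force

lemma lead_mon_mult:
  assumes "p \<noteq> 0"
  shows "lead_mon (mon_poly u * p) = u + lead_mon p"
  using lead_mon[OF assms] by (intro lead_monI) (auto simp: keys_mon_poly_mult grevlex_add_left)

lemma smallest_monomials_initial_segment:
  assumes "finite S" "T \<subseteq> S" "\<And>s t. t \<in> T \<Longrightarrow> s \<in> S \<Longrightarrow> grevlex_less s t \<Longrightarrow> s \<in> T"
  shows "smallest_monomials (card T) S = T"
proof -
  have T: "finite T" using assms finite_subset by blast
  have "card {s \<in> S. grevlex_less s t} < card T" if "t \<in> T" for t
    using that assms(3) grevlex_irrefl by (intro psubset_card_mono[OF T]) auto
  note below = this
  have above: "card T \<le> card {s \<in> S. grevlex_less s t}" if "t \<in> S" "t \<notin> T" for t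
  proof (rule card_mono)
    show "T \<subseteq> {s \<in> S. grevlex_less s t}"
    proof
      fix s assume s: "s \<in> T"
      then have "s \<noteq> t" using that(2) by auto
      moreover have "\<not> grevlex_less t s" using assms(3)[OF s that(1)] that(2) by auto
      ultimately show "s \<in> {s \<in> S. grevlex_less s t}" using grevlex_total[of s t] s assms(2) by auto
    qed
  qed (use assms(1) in simp)
  show ?thesis
    unfolding smallest_monomials_def
  proof (intro equalityI subsetI)
    fix t assume "t \<in> {t \<in> S. card {s \<in> S. grevlex_less s t} < card T}"
    then show "t \<in> T" using above[of t] by (cases "t \<in> T") auto
  next
    fix t assume "t \<in> T"
    then show "t \<in> {t \<in> S. card {s \<in> S. grevlex_less s t} < card T}"
      using below[of t] assms(2) by auto
  qed
qed

section \<open>Ideals of the polynomial ring\<close>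

lemma poly_ring_simps [simp]:
  "carrier (poly_ring n) = {p. keys p \<subseteq> monomials n}"
  "p \<otimes>\<^bsub>poly_ring n\<^esub> q = p * q" "p \<oplus>\<^bsub>poly_ring n\<^esub> q = p + q"
  "\<zero>\<^bsub>poly_ring n\<^esub> = 0" "\<one>\<^bsub>poly_ring n\<^esub> = 1"
  by (simp_all add: poly_ring_def ring_of_type_algebra_def)

lemma carrier_mult:
  assumes "keys p \<subseteq> monomials n" "keys q \<subseteq> monomials n"
  shows "keys (p * q) \<subseteq> monomials n"
proof -
  have "{s + t | s t. s \<in> keys p \<and> t \<in> keys q} \<subseteq> monomials n"
    using assms monomials_add by blast
  then show ?thesis using Poly_Mapping.keys_mult[of p q] by blast
qed

lemma carrier_add:
  "keys p \<subseteq> monomials n \<Longrightarrow> keys q \<subseteq> monomials n \<Longrightarrow> keys (p + q) \<subseteq> monomials n"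
  using Poly_Mapping.keys_add[of p q] by blast

lemma keys_uminus: "keys (- p) = keys p"
  by (auto simp: in_keys_iff)

lemma zero_in_monomials: "0 \<in> monomials n"
  by (simp add: monomials_def)

lemma ring_poly_ring: "ring (poly_ring n :: (nat, 'k::field) mpoly ring)"
proof -
  interpret R: ring "ring_of_type_algebra :: (nat, 'k) mpoly ring" by (rule ring_from_type_algebra)
  have "\<ominus>\<^bsub>ring_of_type_algebra\<^esub> p = - p" for p :: "(nat, 'k) mpoly"
    by (rule R.minus_equality) (auto simp: ring_of_type_algebra_def)
  then have "subring {p :: (nat, 'k) mpoly. keys p \<subseteq> monomials n} ring_of_type_algebra"
    by (intro R.subringI)
      (auto simp: ring_of_type_algebra_def keys_uminus zero_in_monomials
        dest: carrier_mult carrier_add)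
  then show ?thesis unfolding poly_ring_def by (rule R.subring_is_ring)
qed

lemma poly_ring_idealI:
  assumes "\<And>p. p \<in> I \<Longrightarrow> keys p \<subseteq> monomials n" "0 \<in> I"
    and add: "\<And>p q. p \<in> I \<Longrightarrow> q \<in> I \<Longrightarrow> p + q \<in> I"
    and mult: "\<And>p q. p \<in> I \<Longrightarrow> keys q \<subseteq> monomials n \<Longrightarrow> q * p \<in> I"
  shows "ideal I (poly_ring n :: (nat, 'k::field) mpoly ring)"
proof (rule idealI[OF ring_poly_ring])
  interpret R: ring "poly_ring n :: (nat, 'k) mpoly ring" by (rule ring_poly_ring)
  show "subgroup I (add_monoid (poly_ring n))"
  proof (rule R.add.subgroupI)
    fix p assume p: "p \<in> I"
    have "keys (- 1 :: (nat, 'k) mpoly) \<subseteq> monomials n" by (simp add: keys_uminus zero_in_monomials)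
    from mult[OF p this] have "- p \<in> I" by simp
    moreover have "\<ominus>\<^bsub>poly_ring n\<^esub> p = - p"
      using assms(1)[OF p] by (intro R.minus_equality) (auto simp: keys_uminus)
    ultimately show "\<ominus>\<^bsub>poly_ring n\<^esub> p \<in> I" by simp
  qed (use assms in auto)
  show "x \<otimes>\<^bsub>poly_ring n\<^esub> p \<in> I" "p \<otimes>\<^bsub>poly_ring n\<^esub> x \<in> I"
    if "p \<in> I" "x \<in> carrier (poly_ring n)" for p x
    using mult[of p x] that by (auto simp: mult.commute)
qed

lemma poly_ring_idealD:
  assumes "ideal I (poly_ring n :: (nat, 'k::field) mpoly ring)"
  shows "\<And>p. p \<in> I \<Longrightarrow> keys p \<subseteq> monomials n" "0 \<in> I"
    "\<And>p q. p \<in> I \<Longrightarrow> q \<in> I \<Longrightarrow> p + q \<in> I"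
    "\<And>p q. p \<in> I \<Longrightarrow> keys q \<subseteq> monomials n \<Longrightarrow> q * p \<in> I"
proof -
  interpret ideal I "poly_ring n :: (nat, 'k) mpoly ring" by fact
  show "\<And>p. p \<in> I \<Longrightarrow> keys p \<subseteq> monomials n" using a_subset by auto
  show "0 \<in> I" using additive_subgroup.zero_closed[OF additive_subgroup_axioms] by simp
  show "\<And>p q. p \<in> I \<Longrightarrow> q \<in> I \<Longrightarrow> p + q \<in> I"
    using additive_subgroup.a_closed[OF additive_subgroup_axioms] by simp
  show "\<And>p q. p \<in> I \<Longrightarrow> keys q \<subseteq> monomials n \<Longrightarrow> q * p \<in> I" using I_l_closed by simp
qed

lemma ideal_subspace:
  assumes "ideal I (poly_ring n :: (nat, 'k::field) mpoly ring)"
  shows "vs.subspace I"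
proof (rule vs.subspaceI)
  fix c :: 'k and p assume "p \<in> I"
  moreover have "keys (single 0 c :: (nat, 'k) mpoly) \<subseteq> monomials n"
    using zero_in_monomials by auto
  ultimately show "scale c p \<in> I"
    unfolding scale_def by (rule poly_ring_idealD(4)[OF assms])
qed (use poly_ring_idealD[OF assms] in auto)

lemma mon_poly_in_monomial_ideal:
  assumes S: "S \<subseteq> monomials n" and t: "t \<in> monomials n"
  shows "(mon_poly t :: (nat, 'k::field) mpoly) \<in> Idl\<^bsub>poly_ring n\<^esub> (mon_poly ` S)
    \<longleftrightarrow> (\<exists>s\<in>S. \<exists>u. t = u + s)" (is "?l \<longleftrightarrow> ?r")
proof -
  interpret R: ring "poly_ring n :: (nat, 'k) mpoly ring" by (rule ring_poly_ring)
  have carr: "mon_poly ` S \<subseteq> carrier (poly_ring n :: (nat, 'k) mpoly ring)" using S by auto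
  let ?I = "{p :: (nat, 'k) mpoly. keys p \<subseteq> monomials n \<and> (\<forall>t\<in>keys p. \<exists>s\<in>S. \<exists>u. t = u + s)}"
  have "ideal ?I (poly_ring n)"
  proof (rule poly_ring_idealI)
    fix p q :: "(nat, 'k) mpoly" assume p: "p \<in> ?I"
    show "p + q \<in> ?I" if q: "q \<in> ?I"
    proof -
      have "\<exists>s\<in>S. \<exists>u. t = u + s" if "t \<in> keys (p + q)" for t
        using p q subsetD[OF Poly_Mapping.keys_add that] by auto
      then show ?thesis using p q carrier_add[of p n q] by simp
    qed
    show "q * p \<in> ?I" if q: "keys q \<subseteq> monomials n"
    proof -
      have "\<exists>s\<in>S. \<exists>u. t = u + s" if t: "t \<in> keys (q * p)" for t
      proof -
        obtain a b where ab: "t = a + b" "b \<in> keys p"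
          using subsetD[OF Poly_Mapping.keys_mult t] by auto
        then obtain s u where "s \<in> S" "b = u + s" using p by auto
        then have "t = (a + u) + s" using ab by (simp add: add.assoc)
        then show ?thesis using \<open>s \<in> S\<close> by auto
      qed
      then show ?thesis using carrier_mult[OF q] p by simp
    qed
  qed auto
  moreover have "mon_poly ` S \<subseteq> ?I"
    using S by (auto, metis add.left_neutral)
  ultimately have sub: "Idl\<^bsub>poly_ring n\<^esub> (mon_poly ` S) \<subseteq> ?I" by (rule R.genideal_minimal)
  show ?thesis
  proof
    assume ?l
    then show ?r using sub by auto
  next
    assume ?r
    then obtain s u where su: "s \<in> S" "t = u + s" by blast
    then have s: "mon_poly s \<in> Idl\<^bsub>poly_ring n\<^esub> (mon_poly ` S :: (nat, 'k) mpoly set)"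
      using subsetD[OF R.genideal_self[OF carr]] by simp
    have "keys (mon_poly u :: (nat, 'k) mpoly) \<subseteq> monomials n"
      using t su monomials_addD[of u s n] by simp
    then show ?l
      unfolding su(2) mon_poly_add by (rule poly_ring_idealD(4)[OF R.genideal_ideal[OF carr] s])
  qed
qed

section \<open>Homogeneous components\<close>

definition hom_component :: "nat \<Rightarrow> (nat, 'k::field) mpoly \<Rightarrow> (nat, 'k) mpoly" where
  "hom_component e p = (\<Sum>t\<in>{t \<in> keys p. mon_deg t = e}. single t (lookup p t))"

lemma lookup_hom_component:
  "lookup (hom_component e p) t = (if mon_deg t = e then lookup p t else 0)"
  by (simp add: hom_component_def lookup_sum lookup_single when_def in_keys_iff)

lemma hom_component_homogeneous:
  assumes "p \<in> homogeneous_polys n e'"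
  shows "hom_component e p = (if e = e' then p else 0)"
proof (rule poly_mapping_eqI)
  fix t
  have "lookup p t = 0" if "mon_deg t \<noteq> e'"
    using assms that by (auto simp: homogeneous_polys_def monomials_deg_def in_keys_iff subset_iff)
  then show "lookup (hom_component e p) t = lookup (if e = e' then p else 0) t"
    by (auto simp: lookup_hom_component)
qed

lemma ideal_of_forms_eq_span:
  fixes f :: "nat \<Rightarrow> (nat, 'k::field) mpoly"
  assumes f: "\<And>k. k \<in> {1..n} \<Longrightarrow> f k \<in> homogeneous_polys n (d k)"
  shows "Idl\<^bsub>poly_ring n\<^esub> (f ` {1..n}) = vs.span (\<Union>e. gens n d f e)"
proof
  interpret R: ring "poly_ring n :: (nat, 'k) mpoly ring" by (rule ring_poly_ring)
  let ?G = "\<Union>e. gens n d f e"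
  have fc: "keys (f k) \<subseteq> monomials n" if "k \<in> {1..n}" for k
    using f[OF that] by (auto simp: homogeneous_polys_def monomials_deg_def)
  then have carr: "f ` {1..n} \<subseteq> carrier (poly_ring n :: (nat, 'k) mpoly ring)"
    by (intro image_subsetI) (simp only: poly_ring_simps mem_Collect_eq)
  have "ideal (vs.span ?G) (poly_ring n)"
  proof (rule poly_ring_idealI)
    have "?G \<subseteq> vs.span (mon_poly ` monomials n)"
    proof safe
      fix g e assume "g \<in> gens n d f e"
      then have "g \<in> homogeneous_polys n e" using gens_homogeneous f by blast
      then show "g \<in> vs.span (mon_poly ` monomials n)"
        by (auto simp: span_mon_poly homogeneous_polys_def monomials_deg_def)
    qed
    then have "vs.span ?G \<subseteq> vs.span (mon_poly ` monomials n)"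
      by (intro vs.span_minimal vs.subspace_span)
    then show "keys p \<subseteq> monomials n" if "p \<in> vs.span ?G" for p
      using that by (auto simp: span_mon_poly)
    fix p q :: "(nat, 'k) mpoly" assume p: "p \<in> vs.span ?G" and q: "keys q \<subseteq> monomials n"
    show "q * p \<in> vs.span ?G"
    proof (rule mult_span_subset[OF _ vs.subspace_span p])
      fix g assume "g \<in> ?G"
      then obtain k m where km: "k \<in> {1..n}" "m \<in> monomials n" "g = f k * mon_poly m"
        by (auto simp: gens_def cofactors_def)
      have "g * q \<in> vs.span ?G"
      proof (rule mult_span_subset[OF _ vs.subspace_span])
        show "q \<in> vs.span (mon_poly ` monomials n)" using q by (simp add: span_mon_poly)
        fix x :: "(nat, 'k) mpoly" assume "x \<in> mon_poly ` monomials n"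
        then obtain t where t: "t \<in> monomials n" "x = mon_poly t" by auto
        have "(k, m + t) \<in> cofactors n d (mon_deg (m + t) + d k)"
          using km t by (auto simp: cofactors_def monomials_add)
        moreover have "g * x = f k * mon_poly (m + t)" by (simp add: km(3) t(2) mon_poly_add mult.assoc)
        ultimately show "g * x \<in> vs.span ?G" by (intro vs.span_base) (force simp: gens_def)
      qed
      then show "q * g \<in> vs.span ?G" by (simp add: mult.commute)
    qed
  qed (auto intro: vs.span_zero vs.span_add)
  moreover have "f ` {1..n} \<subseteq> vs.span ?G"
    using form_in_span_gens vs.span_mono[of "gens n d f _" ?G] by blast
  ultimately show "Idl\<^bsub>poly_ring n\<^esub> (f ` {1..n}) \<subseteq> vs.span ?G" by (rule R.genideal_minimal)
  note I = R.genideal_ideal[OF carr]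
  show "vs.span ?G \<subseteq> Idl\<^bsub>poly_ring n\<^esub> (f ` {1..n})"
  proof (rule vs.span_minimal[OF _ ideal_subspace[OF I]], safe)
    fix g e assume "g \<in> gens n d f e"
    then obtain k m where km: "k \<in> {1..n}" "m \<in> monomials n" "g = f k * mon_poly m"
      by (auto simp: gens_def cofactors_def)
    have "mon_poly m * f k \<in> Idl\<^bsub>poly_ring n\<^esub> (f ` {1..n})"
      using R.genideal_self[OF carr] km by (intro poly_ring_idealD(4)[OF I]) auto
    then show "g \<in> Idl\<^bsub>poly_ring n\<^esub> (f ` {1..n})" by (simp add: km(3) mult.commute)
  qed
qed

lemma hom_component_in_span_gens:
  fixes f :: "nat \<Rightarrow> (nat, 'k::field) mpoly"
  assumes f: "\<And>k. k \<in> {1..n} \<Longrightarrow> f k \<in> homogeneous_polys n (d k)"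
    and p: "p \<in> vs.span (\<Union>e. gens n d f e)"
  shows "hom_component e p \<in> vs.span (gens n d f e)"
proof -
  let ?V = "{p. hom_component e p \<in> vs.span (gens n d f e)}"
  have "hom_component e (p + q) = hom_component e p + hom_component e q"
    "hom_component e (scale c p) = scale c (hom_component e p)" "hom_component e (0 :: (nat, 'k) mpoly) = 0"
    for p q :: "(nat, 'k) mpoly" and c
    by (auto intro!: poly_mapping_eqI simp: lookup_hom_component lookup_add)
  then have "vs.subspace ?V"
    by (intro vs.subspaceI) (auto intro: vs.span_zero vs.span_add vs.span_scale)
  moreover have "gens n d f e' \<subseteq> ?V" for e'
  proof
    fix g assume g: "g \<in> gens n d f e'"
    then have "g \<in> homogeneous_polys n e'" using gens_homogeneous f by blast
    then show "g \<in> ?V"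
      using g by (auto simp: hom_component_homogeneous intro: vs.span_zero vs.span_base)
  qed
  ultimately have "vs.span (\<Union>e. gens n d f e) \<subseteq> ?V" by (intro vs.span_minimal) auto
  then show ?thesis using p by blast
qed

section \<open>Standard monomials\<close>

text \<open>
  The last two conditions are what genericity of the forms provides; the structure of the standard monomials
  follows from them.
\<close>

locale lefschetz_ideal =
  fixes n :: nat and d :: "nat \<Rightarrow> nat" and f :: "nat \<Rightarrow> (nat, 'k::field) mpoly"
    and J :: "(nat, 'k) mpoly set"
  assumes n_ge_1: "n \<ge> 1"
    and d_ge_1: "\<And>i. i \<in> {1..n} \<Longrightarrow> d i \<ge> 1"
    and forms: "\<And>i. i \<in> {1..n} \<Longrightarrow> f i \<in> homogeneous_polys n (d i)"
    and J_eq: "J = Idl\<^bsub>poly_ring n\<^esub> (f ` {1..n})"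
    and reduced_spanning: "\<And>e. mon_poly ` monomials_deg n e
      \<subseteq> vs.span (gens n d f e \<union> mon_poly ` reduced_monomials n d e)"
    and lefschetz: "lefschetz n d f"
begin

abbreviation "D \<equiv> (\<Sum>i=1..n. d i)"
abbreviation "J_deg e \<equiv> vs.span (gens n d f e)"
abbreviation "std \<equiv> standard_monomials n J"

lemma ideal_J: "ideal J (poly_ring n)"
proof -
  interpret R: ring "poly_ring n :: (nat, 'k) mpoly ring" by (rule ring_poly_ring)
  show ?thesis
    unfolding J_eq using forms
    by (intro R.genideal_ideal) (fastforce simp: homogeneous_polys_def monomials_deg_def)
qed

lemma J_eq_span: "J = vs.span (\<Union>e. gens n d f e)"
  unfolding J_eq by (rule ideal_of_forms_eq_span) (rule forms)

lemma J_deg_subset: "J_deg e \<subseteq> J"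
  unfolding J_eq_span by (rule vs.span_mono) auto

lemma J_deg_homogeneous: "J_deg e \<subseteq> homogeneous_polys n e"
  by (intro vs.span_minimal gens_homogeneous subspace_homogeneous forms)

lemma hom_component_J: "p \<in> J \<Longrightarrow> hom_component e p \<in> J_deg e"
  unfolding J_eq_span by (rule hom_component_in_span_gens) (rule forms)

lemma homogeneous_J: "p \<in> J \<Longrightarrow> p \<in> homogeneous_polys n e \<Longrightarrow> p \<in> J_deg e"
  using hom_component_J[of p e] by (simp add: hom_component_homogeneous)

text \<open>
  Leading monomials of a homogeneous ideal can be detected in the homogeneous part of the same degree: multiply
  an element whose leading monomial divides \<open>t\<close> by the missing monomial, and take the component
  of degree \<open>e\<close>.
\<close>

lemma std_iff:
  "t \<in> std e \<longleftrightarrow> t \<in> monomials_deg n e \<and> (\<forall>p\<in>J_deg e. p \<noteq> 0 \<longrightarrow> lead_mon p \<noteq> t)"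
proof (cases "t \<in> monomials_deg n e")
  case True
  then have t: "t \<in> monomials n" "mon_deg t = e" by (auto simp: monomials_deg_def)
  let ?S = "{lead_mon p | p. p \<in> J \<and> p \<noteq> 0}"
  have S: "?S \<subseteq> monomials n"
    using lead_mon(1) poly_ring_idealD(1)[OF ideal_J] by fast
  have "{mon_poly (lead_mon p) | p. p \<in> J \<and> p \<noteq> 0} = (mon_poly ` ?S :: (nat, 'k) mpoly set)" by auto
  then have "mon_poly t \<in> initial_ideal n J \<longleftrightarrow> (\<exists>s\<in>?S. \<exists>u. t = u + s)"
    unfolding initial_ideal_def using mon_poly_in_monomial_ideal[OF S t(1)] by simp
  also have "\<dots> \<longleftrightarrow> (\<exists>p\<in>J_deg e. p \<noteq> 0 \<and> lead_mon p = t)"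
  proof
    assume "\<exists>s\<in>?S. \<exists>u. t = u + s"
    then obtain p u where p: "p \<in> J" "p \<noteq> 0" "t = u + lead_mon p" by blast
    define q where "q = mon_poly u * p"
    have "u \<in> monomials n" using t(1) p(3) monomials_addD by blast
    then have "q \<in> J" unfolding q_def using poly_ring_idealD(4)[OF ideal_J p(1)] by simp
    have q: "q \<noteq> 0" "lead_mon q = t" using p by (simp_all add: q_def lead_mon_mult)
    have tq: "t \<in> keys (hom_component e q)"
      using lead_mon(1)[OF q(1)] t(2) q(2) by (simp add: in_keys_iff lookup_hom_component)
    moreover have "lead_mon (hom_component e q) = t"
      using tq lead_mon(2)[OF q(1)] q(2)
      by (intro lead_monI) (auto simp: in_keys_iff lookup_hom_component split: if_splits)
    ultimately show "\<exists>p\<in>J_deg e. p \<noteq> 0 \<and> lead_mon p = t"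
      using hom_component_J[OF \<open>q \<in> J\<close>, of e] by (intro bexI[of _ "hom_component e q"]) auto
  next
    assume "\<exists>p\<in>J_deg e. p \<noteq> 0 \<and> lead_mon p = t"
    then have "t \<in> ?S" using J_deg_subset by blast
    moreover have "\<exists>u. t = u + t" by (rule exI[of _ 0]) simp
    ultimately show "\<exists>s\<in>?S. \<exists>u. t = u + s" by (rule bexI[rotated])
  qed
  finally show ?thesis using True by (auto simp: standard_monomials_def)
qed (simp add: standard_monomials_def)

lemma std_subset: "std e \<subseteq> monomials_deg n e"
  by (auto simp: std_iff)

lemma finite_std: "finite (std e)"
  by (rule finite_subset[OF std_subset]) simp

lemma std_divisor:
  assumes "u + s \<in> std (b + e)" "s \<in> monomials_deg n e" "u \<in> monomials_deg n b"
  shows "s \<in> std e"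
  unfolding std_iff
proof (intro conjI ballI impI notI)
  fix p assume p: "p \<in> J_deg e" "p \<noteq> 0" "lead_mon p = s"
  have "mon_poly u * p \<in> J_deg (b + e)"
    by (rule span_gens_mult[OF p(1) mon_poly_homogeneous[OF assms(3)]])
  moreover have "mon_poly u * p \<noteq> 0" using p(2) by simp
  ultimately show False using assms(1) p by (auto simp: std_iff lead_mon_mult)
qed (fact assms(2))

text \<open>
  Macaulay's basis theorem, together with \<open>std_independent_mod\<close>. The least monomial outside the span would be the
  leading monomial of an element of the ideal, all of whose other monomials lie in the span.
\<close>

lemma std_spanning: "mon_poly ` monomials_deg n e \<subseteq> vs.span (mon_poly ` std e \<union> J_deg e)"
proof (rule ccontr)
  let ?V = "vs.span (mon_poly ` std e \<union> J_deg e)"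
  define bad where "bad = {t \<in> monomials_deg n e. (mon_poly t :: (nat, 'k) mpoly) \<notin> ?V}"
  assume "\<not> mon_poly ` monomials_deg n e \<subseteq> ?V"
  then have "finite bad" "bad \<noteq> {}" by (auto simp: bad_def)
  from grevlex_least[OF this] obtain t where
    t: "t \<in> bad" "\<And>s. s \<in> bad \<Longrightarrow> s \<noteq> t \<Longrightarrow> grevlex_less t s" by auto
  have "t \<notin> std e" using t(1) by (auto simp: bad_def intro: vs.span_base)
  then obtain p where p: "p \<in> J_deg e" "p \<noteq> 0" "lead_mon p = t"
    using t(1) by (auto simp: std_iff bad_def)
  have tp: "t \<in> keys p" and less: "\<And>s. s \<in> keys p \<Longrightarrow> s \<noteq> t \<Longrightarrow> grevlex_less s t"
    using lead_mon[OF p(2)] p(3) by auto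
  have "mon_poly s \<in> ?V" if "s \<in> keys p - {t}" for s
  proof -
    have "s \<in> monomials_deg n e" using p(1) J_deg_homogeneous that by (auto simp: homogeneous_polys_def)
    moreover have "s \<notin> bad" using t(2)[of s] less[of s] that grevlex_asym by blast
    ultimately show ?thesis by (simp add: bad_def)
  qed
  then have rest: "(\<Sum>s\<in>keys p - {t}. scale (lookup p s) (mon_poly s)) \<in> ?V"
    by (intro vs.span_sum vs.span_scale)
  have "p = scale (lookup p t) (mon_poly t) + (\<Sum>s\<in>keys p - {t}. scale (lookup p s) (mon_poly s))"
    using tp by (subst sum.remove[symmetric]) (auto simp: sum_monomials[symmetric])
  then have "scale (lookup p t) (mon_poly t) = p - (\<Sum>s\<in>keys p - {t}. scale (lookup p s) (mon_poly s))"
    by (simp add: algebra_simps)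
  also have "\<dots> \<in> ?V" using p(1) by (intro vs.span_diff rest vs.span_base) simp
  finally have "scale (inverse (lookup p t)) (scale (lookup p t) (mon_poly t)) \<in> ?V"
    by (rule vs.span_scale)
  moreover have "lookup p t \<noteq> 0" using tp by (simp add: in_keys_iff)
  ultimately show False using t(1) by (simp add: bad_def)
qed

lemma std_independent_mod: "vs.span (mon_poly ` std e) \<inter> J_deg e \<subseteq> {0}"
proof safe
  fix p assume p: "p \<in> vs.span (mon_poly ` std e)" "p \<in> J_deg e"
  show "p = 0"
  proof (rule ccontr)
    assume "p \<noteq> 0"
    then have "lead_mon p \<in> std e" using lead_mon(1)[of p] p(1) by (auto simp: span_mon_poly)
    then show False using p(2) \<open>p \<noteq> 0\<close> by (auto simp: std_iff)
  qed
qed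

lemma card_std: "card (std e) = card (reduced_monomials n d e)"
proof -
  have card: "card (mon_poly ` Z :: (nat, 'k) mpoly set) = card Z" for Z
    by (rule card_image) (rule inj_on_subset[OF inj_mon_poly subset_UNIV])
  have fin: "finite (reduced_monomials n d e)" by (simp add: reduced_monomials_def)
  have bound: "J_deg e \<subseteq> vs.span (mon_poly ` monomials_deg n e)"
    using J_deg_homogeneous by (simp add: homogeneous_polys_eq_span)
  have "card (mon_poly ` std e :: (nat, 'k) mpoly set) \<le> card (mon_poly ` reduced_monomials n d e :: (nat, 'k) mpoly set)"
  proof (rule vs.card_le_of_independent_mod[OF independent_mon_poly _ std_independent_mod vs.subspace_span bound])
    have "vs.span (gens n d f e \<union> mon_poly ` reduced_monomials n d e)
        \<subseteq> vs.span (mon_poly ` reduced_monomials n d e \<union> J_deg e)"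
      using vs.span_superset[of "gens n d f e"] by (intro vs.span_mono) auto
    then show "mon_poly ` std e \<subseteq> vs.span (mon_poly ` reduced_monomials n d e \<union> J_deg e)"
      using reduced_spanning[of e] std_subset[of e] by blast
  qed (use finite_std fin in auto)
  moreover have "card (mon_poly ` reduced_monomials n d e :: (nat, 'k) mpoly set) \<le> card (mon_poly ` std e :: (nat, 'k) mpoly set)"
  proof (rule vs.card_le_of_independent_mod[OF independent_mon_poly _
        reduced_independent_mod[OF d_ge_1 reduced_spanning] vs.subspace_span bound])
    show "mon_poly ` reduced_monomials n d e \<subseteq> vs.span (mon_poly ` std e \<union> J_deg e)"
      using std_spanning[of e] by (auto simp: reduced_monomials_def)
  qed (use finite_std fin in auto)
  ultimately show ?thesis unfolding card by (rule antisym)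
qed

lemma std_empty: "e > D - n \<Longrightarrow> std e = {}"
  using card_std[of e] reduced_monomials_empty[of n d e, OF d_ge_1] finite_std by simp

text \<open>
  Modulo the ideal, a monomial \<open>t\<close> of degree \<open>e\<close> is congruent to a combination of monomials with
  exponent at least \<open>r\<close> at the last variable. If the exponent of \<open>t\<close> is smaller, all these monomials are smaller
  than \<open>t\<close>, so \<open>t\<close> is a leading monomial.
\<close>

lemma std_high:
  assumes "2 * e + n = D + r"
  shows "std e \<subseteq> high_monomials n e r"
proof
  fix t assume t: "t \<in> std e"
  then have tM: "t \<in> monomials_deg n e" using std_subset by blast
  show "t \<in> high_monomials n e r"
  proof (rule ccontr)
    assume not_high: "t \<notin> high_monomials n e r"
    have "mon_poly t \<in> vs.span (gens n d f e \<union> mon_poly ` high_monomials n e r)"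
      using lefschetz assms tM by (auto simp: lefschetz_def)
    then obtain g h where gh: "g \<in> J_deg e" "h \<in> vs.span (mon_poly ` high_monomials n e r)"
      "mon_poly t = g + h"
      unfolding vs.span_Un by blast
    have g: "lookup g s = lookup (mon_poly t) s - lookup h s" for s
      by (simp add: gh(3) lookup_add)
    have kh: "keys h \<subseteq> high_monomials n e r" using gh(2) by (simp add: span_mon_poly)
    have "t \<notin> keys h" using kh not_high by blast
    then have tg: "t \<in> keys g" using g[of t] by (simp add: in_keys_iff lookup_mon_poly)
    moreover have "grevlex_less s t" if "s \<in> keys g" "s \<noteq> t" for s
    proof -
      have "s \<in> keys h" using that g[of s] by (auto simp: in_keys_iff lookup_mon_poly)
      then have "s \<in> monomials_deg n e" "lookup t n < lookup s n"
        using kh not_high tM by (auto simp: high_monomials_def)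
      then show ?thesis using grevlex_last_exponent(1) tM by blast
    qed
    ultimately have "lead_mon g = t" by (rule lead_monI)
    moreover have "g \<noteq> 0" using tg by auto
    ultimately show False using t gh(1) by (auto simp: std_iff)
  qed
qed

lemma var_pow_monomial: "var_pow n r \<in> monomials_deg n r"
  using n_ge_1 by (auto simp: var_pow_def monomials_deg_def single_in_monomials)

lemma std_divide_power:
  assumes t: "t \<in> std (e + r)" "r \<le> lookup t n"
  shows "t \<in> mon_times_set (var_pow n r) (std e)"
proof -
  define u where "u = t - single n r"
  have eq: "t = var_pow n r + u" unfolding u_def var_pow_def by (rule split_off_power[OF t(2)])
  have "t \<in> monomials_deg n (e + r)" using t(1) std_subset by blast
  then have "u \<in> monomials_deg n e"
    using eq monomials_addD[of "var_pow n r" u n] by (auto simp: var_pow_def monomials_deg_def mon_deg_add)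
  then have "u \<in> std e"
    using std_divisor[of "var_pow n r" u r e] var_pow_monomial t(1) eq by (simp add: add.commute)
  then show ?thesis using eq by (simp add: mon_times_set_def)
qed

lemma card_mon_times_set: "card (mon_times_set m S) = card S"
  unfolding mon_times_set_def by (rule card_image) simp

text \<open>
  Divisibility by the power of \<open>x\<^sub>n\<close> gives one inclusion, and the symmetry of the Hilbert function turns it into
  an equality.
\<close>

theorem std_symmetric:
  assumes "e + e' + n = D" "e' \<le> e"
  shows "std e = mon_times_set (var_pow n (e - e')) (std e')"
proof (rule card_subset_eq)
  show "finite (mon_times_set (var_pow n (e - e')) (std e'))"
    by (simp add: mon_times_set_def finite_std)
  have "std e \<subseteq> high_monomials n e (e - e')" using assms by (intro std_high) simp
  then show "std e \<subseteq> mon_times_set (var_pow n (e - e')) (std e')"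
    using std_divide_power[of _ e' "e - e'"] assms(2) by (auto simp: high_monomials_def)
  have "card (std e) = card (std e')"
    unfolding card_std using assms card_reduced_le[of n d, OF d_ge_1] by (intro antisym) (auto simp: add_ac)
  then show "card (std e) = card (mon_times_set (var_pow n (e - e')) (std e'))"
    by (simp add: card_mon_times_set)
qed

end

section \<open>Multiplication by powers of the last variable\<close>

lemma ideal_coset_eq_iff:
  fixes J :: "(nat, 'k::field) mpoly set"
  assumes "ideal J (poly_ring n)"
  shows "J +>\<^bsub>poly_ring n\<^esub> p = J +>\<^bsub>poly_ring n\<^esub> q \<longleftrightarrow> p - q \<in> J"
proof -
  note J = ideal_subspace[OF assms]
  have coset: "J +>\<^bsub>poly_ring n\<^esub> p = (\<lambda>h. h + p) ` J" for p
    by (auto simp: a_r_coset_def')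
  show ?thesis
  proof
    assume "J +>\<^bsub>poly_ring n\<^esub> p = J +>\<^bsub>poly_ring n\<^esub> q"
    moreover have "p \<in> J +>\<^bsub>poly_ring n\<^esub> p" using vs.subspace_0[OF J] by (force simp: coset)
    ultimately obtain h where "h \<in> J" "p = h + q" by (auto simp: coset)
    then show "p - q \<in> J" by simp
  next
    have sub: "J +>\<^bsub>poly_ring n\<^esub> p \<subseteq> J +>\<^bsub>poly_ring n\<^esub> q" if "p - q \<in> J" for p q
    proof
      fix x assume "x \<in> J +>\<^bsub>poly_ring n\<^esub> p"
      then obtain h where h: "h \<in> J" "x = h + p" by (auto simp: coset)
      then have "x = (h + (p - q)) + q" "h + (p - q) \<in> J"
        using vs.subspace_add[OF J _ that] by simp_all
      then show "x \<in> J +>\<^bsub>poly_ring n\<^esub> q" unfolding coset by blast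
    qed
    assume "p - q \<in> J"
    moreover from this have "q - p \<in> J" using vs.subspace_neg[OF J] by fastforce
    ultimately show "J +>\<^bsub>poly_ring n\<^esub> p = J +>\<^bsub>poly_ring n\<^esub> q" using sub by blast
  qed
qed

lemma quotient_mult_coset:
  fixes J :: "(nat, 'k::field) mpoly set"
  assumes J: "ideal J (poly_ring n)" and "m \<in> monomials n" "keys p \<subseteq> monomials n"
  shows "quotient_mult n J m (J +>\<^bsub>poly_ring n\<^esub> p) = J +>\<^bsub>poly_ring n\<^esub> (mon_poly m * p)"
  unfolding quotient_mult_def FactRing_def
  using ideal.rcoset_mult_add[OF J, of "mon_poly m" p] assms(2,3) by simp

context lefschetz_ideal begin

text \<open>
  By \<open>grevlex_last_exponent\<close>, a lower bound on the last exponent cuts out an initial segment.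
\<close>

lemma initial_segment_std:
  "smallest_monomials (card {t \<in> std e. c \<le> lookup t n}) (std e) = {t \<in> std e. c \<le> lookup t n}"
proof (rule smallest_monomials_initial_segment[OF finite_std])
  fix s t assume "t \<in> {t \<in> std e. c \<le> lookup t n}" "s \<in> std e" "grevlex_less s t"
  moreover from this have "lookup t n \<le> lookup s n"
    by (intro grevlex_last_exponent(2)[of s n e t]) (auto dest: subsetD[OF std_subset])
  ultimately show "s \<in> {t \<in> std e. c \<le> lookup t n}" by auto
qed auto

lemma std_power_multiples:
  assumes "mon_times_set (var_pow n r) (std j) \<subseteq> std (j + r)"
  shows "mon_times_set (var_pow n r) (std j) = {t \<in> std (j + r). r \<le> lookup t n}"
proof
  show "mon_times_set (var_pow n r) (std j) \<subseteq> {t \<in> std (j + r). r \<le> lookup t n}"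
    using assms by (auto simp: mon_times_set_def var_pow_def lookup_add)
  show "{t \<in> std (j + r). r \<le> lookup t n} \<subseteq> mon_times_set (var_pow n r) (std j)"
    using std_divide_power by auto
qed

text \<open>
  In this range \<open>x\<^sub>n\<^sup>r t\<close> with \<open>t \<in> std j\<close> divides \<open>x\<^sub>n\<^bsup>q + r\<^esup> t\<close>, which is standard by symmetry when
  \<open>j + q + r\<close> is the mirror degree of \<open>j\<close>.
\<close>

lemma std_power_mult:
  assumes "2 * j + r + n \<le> D"
  shows "mon_times_set (var_pow n r) (std j) \<subseteq> std (j + r)"
proof
  fix t assume "t \<in> mon_times_set (var_pow n r) (std j)"
  then obtain s where s: "s \<in> std j" "t = var_pow n r + s" by (auto simp: mon_times_set_def)
  define q where "q = D - n - (2 * j + r)"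
  have q: "j + r + (j + q) + n = D" using assms by (simp add: q_def)
  have "std (j + (q + r)) = mon_times_set (var_pow n (q + r)) (std j)"
    using std_symmetric[of "j + (q + r)" j] q by simp
  moreover have "var_pow n (q + r) + s = var_pow n q + t"
    by (simp add: s(2) var_pow_def single_add add.assoc)
  ultimately have "var_pow n q + t \<in> std (q + (j + r))"
    using s(1) by (simp add: mon_times_set_def add_ac) (metis imageI)
  moreover have "t \<in> monomials_deg n (j + r)"
    unfolding s(2) using monomials_deg_add[OF var_pow_monomial, of s j r] s(1) std_subset
    by (auto simp: add.commute)
  ultimately show "t \<in> std (j + r)" using std_divisor var_pow_monomial by blast
qed

theorem std_power_segments:
  assumes j: "j \<le> D - n"
  shows "card (std j) \<le> card (std (j + r)) \<Longrightarrow>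
      smallest_monomials (card (std j)) (std (j + r)) = mon_times_set (var_pow n r) (std j)"
    and "card (std j) \<ge> card (std (j + r)) \<Longrightarrow>
      std (j + r) = mon_times_set (var_pow n r) (smallest_monomials (card (std (j + r))) (std j))"
proof -
  have n_le_D: "n \<le> D" using sum_pred[of n d, OF d_ge_1] by simp
  let ?y = "\<lambda>r. mon_times_set (var_pow n r)"
  have all: "smallest_monomials (card (std e)) (std e) = std e" for e
    using initial_segment_std[of e 0] by simp
  \<comment> \<open>The degrees \<open>j\<close> and \<open>j + r\<close> are compared with the middle degree: multiplication is injective in
    the first case and surjective in the other two.\<close>
  consider "2 * j + r + n \<le> D" | "j + r > D - n" | "2 * j + r + n > D" "j + r \<le> D - n" by linarith
  then have "(card (std j) \<le> card (std (j + r)) \<longrightarrow>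
      smallest_monomials (card (std j)) (std (j + r)) = ?y r (std j)) \<and>
    (card (std j) \<ge> card (std (j + r)) \<longrightarrow>
      std (j + r) = ?y r (smallest_monomials (card (std (j + r))) (std j)))"
  proof cases
    case 1
    note sub = std_power_mult[OF 1]
    have "smallest_monomials (card (std j)) (std (j + r)) = ?y r (std j)"
      using initial_segment_std[of "j + r" r] unfolding std_power_multiples[OF sub, symmetric]
      by (simp add: card_mon_times_set)
    moreover have "std (j + r) = ?y r (smallest_monomials (card (std (j + r))) (std j))"
      if "card (std (j + r)) \<le> card (std j)"
    proof -
      have "?y r (std j) = std (j + r)"
        using that by (intro card_seteq[OF finite_std sub]) (simp add: card_mon_times_set)
      then show ?thesis using all[of j] card_mon_times_set by metis
    qed
    ultimately show ?thesis by blast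
  next
    case 2
    then have "std (j + r) = {}" by (rule std_empty)
    then show ?thesis
      using finite_std[of j] by (auto simp: smallest_monomials_def mon_times_set_def)
  next
    case 3
    \<comment> \<open>Let \<open>i\<close> be the mirror degree of \<open>j + r\<close>. The standard monomials of degree \<open>j + r\<close> arise from
      those of degree \<open>i \<le> j\<close>, and on the way they pass through the set \<open>T\<close> in degree \<open>j\<close>.\<close>
    define i where "i = D - n - (j + r)"
    have i: "j + r + i + n = D" "i \<le> j" using 3 n_le_D by (auto simp: i_def)
    have k: "std (j + r) = ?y (j + r - i) (std i)"
      using std_symmetric[OF i(1)] i(2) by simp
    define T where "T = ?y (j - i) (std i)"
    have "var_pow n (j + r - i) = var_pow n r + var_pow n (j - i)"
      using i(2) by (simp add: var_pow_def single_add[symmetric] add.commute)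
    then have kT: "std (j + r) = ?y r T"
      by (simp add: k T_def mon_times_set_def image_image add.assoc)
    have "T \<subseteq> std j"
    proof
      fix t assume t: "t \<in> T"
      then obtain s where s: "s \<in> std i" "t = var_pow n (j - i) + s" by (auto simp: T_def mon_times_set_def)
      have "t \<in> monomials_deg n (j - i + i)"
        unfolding s(2) using s(1) std_subset by (intro monomials_deg_add var_pow_monomial) auto
      moreover have "var_pow n r + t \<in> std (r + j)" using t kT by (auto simp: mon_times_set_def add.commute)
      ultimately show "t \<in> std j" using std_divisor var_pow_monomial i(2) by simp
    qed
    then have "T = {t \<in> std j. j - i \<le> lookup t n}"
      using std_power_multiples[of "j - i" i] i(2) by (simp add: T_def)
    then have sT: "smallest_monomials (card T) (std j) = T"
      using initial_segment_std by simp
    have card: "card (std (j + r)) = card T" by (simp add: kT card_mon_times_set)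
    have "smallest_monomials (card (std j)) (std (j + r)) = ?y r (std j)"
      if "card (std j) \<le> card (std (j + r))"
    proof -
      have "T = std j" using that card by (intro card_seteq[OF finite_std \<open>T \<subseteq> std j\<close>]) simp
      then show ?thesis using all[of "j + r"] kT card by simp
    qed
    then show ?thesis using sT kT card by simp
  qed
  then show "card (std j) \<le> card (std (j + r)) \<Longrightarrow>
      smallest_monomials (card (std j)) (std (j + r)) = ?y r (std j)"
    "card (std j) \<ge> card (std (j + r)) \<Longrightarrow>
      std (j + r) = ?y r (smallest_monomials (card (std (j + r))) (std j))"
    by blast+
qed

text \<open>
  In this range \<open>x\<^sub>n\<^sup>r\<close> maps standard monomials to standard monomials, and distinct standard monomials are
  independent modulo the ideal.
\<close>

lemma power_mult_injective:
  assumes num: "2 * j + r + n \<le> D" and p: "p \<in> homogeneous_polys n j"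
    and J: "mon_poly (var_pow n r) * p \<in> J"
  shows "p \<in> J"
proof -
  let ?x = "mon_poly (var_pow n r) :: (nat, 'k) mpoly"
  have x: "?x \<in> homogeneous_polys n r" by (intro mon_poly_homogeneous var_pow_monomial)
  have "vs.span (mon_poly ` monomials_deg n j) \<subseteq> vs.span (mon_poly ` std j \<union> J_deg j)"
    by (intro vs.span_minimal std_spanning vs.subspace_span)
  then have "p \<in> vs.span (mon_poly ` std j \<union> J_deg j)"
    using p unfolding homogeneous_polys_eq_span by blast
  then obtain q g where qg: "q \<in> vs.span (mon_poly ` std j)" "g \<in> J_deg j" "p = q + g"
    unfolding vs.span_Un by (auto simp: vs.span_span)
  have "?x * q = ?x * p - ?x * g" by (simp add: qg(3) distrib_left)
  moreover have "?x * g \<in> J_deg (r + j)" by (rule span_gens_mult[OF qg(2) x])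
  moreover have "?x * p \<in> J_deg (r + j)" by (rule homogeneous_J[OF J homogeneous_mult[OF x p]])
  ultimately have "?x * q \<in> J_deg (j + r)" by (simp add: vs.span_diff add.commute)
  moreover have "keys (?x * q) \<subseteq> std (j + r)"
    using qg(1) std_power_mult[OF num] by (auto simp: keys_mon_poly_mult span_mon_poly mon_times_set_def)
  ultimately have "?x * q = 0" using std_independent_mod[of "j + r"] by (auto simp: span_mon_poly)
  then have "q = 0" by simp
  then show ?thesis using qg J_deg_subset by auto
qed

text \<open>
  The map in question is the second factor of the surjective multiplication by \<open>x\<^sub>n\<^bsup>c + r\<^esup>\<close> that starts in
  degree \<open>j - c\<close>, the mirror degree of \<open>j + r\<close>.
\<close>

lemma power_mult_surjective:
  assumes num: "D \<le> 2 * j + r + n" and p: "p \<in> homogeneous_polys n (j + r)"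
  shows "\<exists>q\<in>homogeneous_polys n j. p - mon_poly (var_pow n r) * q \<in> J"
proof -
  define c where "c = 2 * j + r + n - D"
  have "mon_poly ` monomials_deg n (j + r)
      \<subseteq> vs.span (gens n d f (j + r) \<union> mon_poly ` high_monomials n (j + r) (c + r))"
    using lefschetz num by (auto simp: lefschetz_def c_def)
  then have "p \<in> vs.span (gens n d f (j + r) \<union> mon_poly ` high_monomials n (j + r) (c + r))"
    using p vs.span_minimal[OF _ vs.subspace_span] unfolding homogeneous_polys_eq_span by blast
  then obtain g h where gh: "g \<in> J_deg (j + r)"
    "h \<in> vs.span (mon_poly ` high_monomials n (j + r) (c + r))" "p = g + h"
    unfolding vs.span_Un by blast
  have gJ: "g \<in> J" using gh(1) J_deg_subset by blast
  from span_high_monomials[OF gh(2)] show ?thesis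
  proof
    assume "h = 0"
    then show ?thesis using gh(3) gJ vs.subspace_0[OF subspace_homogeneous] by force
  next
    assume "c + r \<le> j + r \<and> (\<exists>p'\<in>homogeneous_polys n (j + r - (c + r)). h = mon_poly (single n (c + r)) * p')"
    then obtain p' where p': "c \<le> j" "p' \<in> homogeneous_polys n (j - c)" "h = mon_poly (single n (c + r)) * p'"
      by auto
    have "mon_poly (var_pow n c) * p' \<in> homogeneous_polys n (c + (j - c))"
      by (intro homogeneous_mult mon_poly_homogeneous var_pow_monomial p'(2))
    moreover have "h = mon_poly (var_pow n r) * (mon_poly (var_pow n c) * p')"
      unfolding p'(3) mult.assoc[symmetric] mon_poly_add[symmetric]
      by (simp add: var_pow_def single_add[symmetric] add.commute)
    ultimately show ?thesis
      using p'(1) gh(3) gJ by (intro bexI[of _ "mon_poly (var_pow n c) * p'"]) simp_all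
  qed
qed

theorem power_mult_inj_or_surj:
  "inj_on (quotient_mult n J (var_pow n r)) (quotient_piece n J j) \<or>
   quotient_mult n J (var_pow n r) ` quotient_piece n J j = quotient_piece n J (j + r)"
proof -
  let ?\<mu> = "quotient_mult n J (var_pow n r)" and ?x = "mon_poly (var_pow n r) :: (nat, 'k) mpoly"
  have x: "?x \<in> homogeneous_polys n r" by (intro mon_poly_homogeneous var_pow_monomial)
  have \<mu>: "?\<mu> (J +>\<^bsub>poly_ring n\<^esub> p) = J +>\<^bsub>poly_ring n\<^esub> (?x * p)"
    if "p \<in> homogeneous_polys n j" for p
    using that var_pow_monomial[of r]
    by (intro quotient_mult_coset[OF ideal_J]) (auto simp: homogeneous_polys_def monomials_deg_def)
  show ?thesis
  proof (cases "2 * j + r + n \<le> D")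
    case True
    have "inj_on ?\<mu> (quotient_piece n J j)"
    proof (rule inj_onI)
      fix a b assume ab: "a \<in> quotient_piece n J j" "b \<in> quotient_piece n J j" "?\<mu> a = ?\<mu> b"
      then obtain p q where p: "p \<in> homogeneous_polys n j" "a = J +>\<^bsub>poly_ring n\<^esub> p"
        and q: "q \<in> homogeneous_polys n j" "b = J +>\<^bsub>poly_ring n\<^esub> q"
        by (auto simp: quotient_piece_def)
      have "?x * (p - q) \<in> J"
        using ab(3) p q by (simp add: \<mu> ideal_coset_eq_iff[OF ideal_J] right_diff_distrib)
      then have "p - q \<in> J"
        using power_mult_injective[OF True] p(1) q(1) vs.subspace_diff[OF subspace_homogeneous] by blast
      then show "a = b" by (simp add: p q ideal_coset_eq_iff[OF ideal_J])
    qed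
    then show ?thesis ..
  next
    case False
    have "?\<mu> ` quotient_piece n J j = quotient_piece n J (j + r)"
    proof (intro equalityI subsetI)
      fix a assume "a \<in> ?\<mu> ` quotient_piece n J j"
      then obtain p where "p \<in> homogeneous_polys n j" "a = J +>\<^bsub>poly_ring n\<^esub> (?x * p)"
        by (auto simp: quotient_piece_def \<mu>)
      then show "a \<in> quotient_piece n J (j + r)"
        using homogeneous_mult[OF x] by (auto simp: quotient_piece_def add.commute)
    next
      fix a assume "a \<in> quotient_piece n J (j + r)"
      then obtain p where p: "p \<in> homogeneous_polys n (j + r)" "a = J +>\<^bsub>poly_ring n\<^esub> p"
        by (auto simp: quotient_piece_def)
      then obtain q where "q \<in> homogeneous_polys n j" "p - ?x * q \<in> J"
        using power_mult_surjective[of j r p] False by auto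
      then have "a = ?\<mu> (J +>\<^bsub>poly_ring n\<^esub> q)" "J +>\<^bsub>poly_ring n\<^esub> q \<in> quotient_piece n J j"
        by (auto simp: p(2) \<mu> ideal_coset_eq_iff[OF ideal_J] quotient_piece_def)
      then show "a \<in> ?\<mu> ` quotient_piece n J j" by blast
    qed
    then show ?thesis ..
  qed
qed

end

lemma generic_ideal_lefschetz:
  fixes F :: "'k::field set"
  assumes F: "subfield F (ring_of_type_algebra :: 'k ring)" and "n \<ge> 1"
    and f: "generic_forms F n d f" and J: "J = Idl\<^bsub>poly_ring n\<^esub> (f ` {1..n})"
  shows "lefschetz_ideal n d f J"
  using assms generic_reduced_spanning[OF F f] generic_lefschetz[OF F f]
  by unfold_locales (auto simp: generic_forms_def)

theorem lemma3p5:
  fixes F :: "'k::field set"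
    and J :: "(nat, 'k) mpoly set"
    and d :: "nat \<Rightarrow> nat"
    and n j r :: nat
  defines "B \<equiv> standard_monomials n J"
    and "A \<equiv> quotient_piece n J"
    and "\<mu> \<equiv> quotient_mult n J (var_pow n r)"
  assumes "infinite (UNIV :: 'k set)"
    and "subfield F (ring_of_type_algebra :: 'k ring)"
    and "n \<ge> 1"
    and "generic_ideal F n d J"
    and "j \<le> (\<Sum>i=1..n. d i) - n"
  shows "(inj_on \<mu> (A j) \<or> \<mu> ` A j = A (j + r)) \<and>
    (card (B j) \<le> card (B (j + r)) \<longrightarrow>
       smallest_monomials (card (B j)) (B (j + r)) = mon_times_set (var_pow n r) (B j)) \<and>
    (card (B j) \<ge> card (B (j + r)) \<longrightarrow>
       B (j + r) = mon_times_set (var_pow n r) (smallest_monomials (card (B (j + r))) (B j)))"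
proof -
  obtain f where "generic_forms F n d f" "J = Idl\<^bsub>poly_ring n\<^esub> (f ` {1..n})"
    using \<open>generic_ideal F n d J\<close> by (auto simp: generic_ideal_def)
  with assms interpret lefschetz_ideal n d f J by (intro generic_ideal_lefschetz)
  show ?thesis
    unfolding B_def A_def \<mu>_def
    using power_mult_inj_or_surj std_power_segments[OF assms(8)] by blast
qed

end
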